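(* Let $(\zeta,q,\underline P)$ be a regular solution of the constrained shallow water models (described in the context) with $\kappa=0$, whose discharge is continuous at the contact points, i.e. $q_{|_{\mathcal E}}=q_i$ at $x=\pm r$. Suppose that the following shallow water Bernoulli principles hold at the contact points: $$\zeta_{\rm w}+\frac{\underline P_{|_{\mathcal I}}}{\varepsilon}+\varepsilon\frac{q_i^2}{2h_{\rm w}^2}=\zeta_{|_{\mathcal E}}+\mathfrak E_{|_{\mathcal E}}\quad\text{at }x=-r,$$ $$\zeta_{\rm w}+\frac{\underline P_{|_{\mathcal I}}}{\varepsilon}+\varepsilon\frac{q_i^2}{2h_{\rm w}^2}=\zeta_{|_{\mathcal E}}+P_0(I-\kappa\mathcal D)\overline\zeta+\mathfrak E_{|_{\mathcal E}}\quad\text{at }x=r,$$ where $\mathfrak E(\zeta,q)=\varepsilon\frac{q^2}{2h^2}-\mu\frac{\partial_x\partial_t q}{3h}$. Then the total energy is conserved at order $O(\varepsilon\mu)$, that is, $$\frac{d}{dt}E_{\rm tot}(\zeta,q)=\varepsilon\mu\int_{-\infty}^{\ell}R(\zeta,q)\,dx .$$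
   Context: Parameters: $\varepsilon\in(0,1]$, $\mu\ge 0$, $0<r<\ell$, $P_0>0$, $\kappa\ge0$. Domains: $\mathcal I=(-r,r)$, $\mathcal E_-=(-\infty,-r)$, $\mathcal E_+=(r,\ell)$, $\mathcal E=\mathcal E_-\cup\mathcal E_+$, $|\mathcal E_+|=\ell-r$; the contact points are $x=\pm r$. $\zeta_{\rm w}$ is a constant (flat bottom of the immersed structure) and $h_{\rm w}=1+\varepsilon\zeta_{\rm w}>0$. For a function $\zeta(t,x)$, $h=1+\varepsilon\zeta>0$ and $\overline\zeta(t)=\frac1{|\mathcal E_+|}\int_{\mathcal E_+}\zeta(t,x)\,dx$. $I$ is the identity and $\mathcal D f(t)=\int_0^te^{-\kappa(t-s)}f(s)\,ds$. Constrained shallow water models: the unknowns $\zeta,q,\underline P$ (functions of $t$ and $x\in(-\infty,\ell)$) satisfy, in each of $\mathcal E_-,\mathcal I,\mathcal E_+$, $$\partial_t\zeta+\partial_xq=0,\qquad \Big(1-\frac\mu3\partial_x^2\Big)\partial_tq+\varepsilon\partial_x\Big(\frac{q^2}h\Big)+h\,\partial_x\zeta=-\frac h\varepsilon\partial_x\underline P,$$ with $(\zeta,q)\to(0,0)$ as $x\to-\infty$, $q=0$ at $x=\ell$, and the constraints $\zeta=\zeta_{\rm w}$ in $\mathcal I$, $\underline P=0$ in $\mathcal E_-$, $\underline P=\varepsilon P_0(I-\kappa\mathcal D)\overline\zeta$ in $\mathcal E_+$. Consequently in $\mathcal I$ one has $q=q_i(t)$ (independent of $x$) and $\frac{dq_i}{dt}=-\frac{h_{\rm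 w}}\varepsilon\partial_x\underline P$. "Regular" means sufficiently smooth up to the boundary on each of $\mathcal E_-,\mathcal I,\mathcal E_+$ (with possible jumps at $x=\pm r$) and sufficiently decaying at $-\infty$. A subscript $|_{D}$ denotes restriction to $D$; the value of $F_{|_D}$ at $x=\pm r$ is the trace taken from $D$. Total energy: $$E_{\rm tot}(\zeta,q)=\int_{-\infty}^\ell\Big(\frac{\zeta^2}2+\frac{q^2}{2h}+\mu\frac{(\partial_xq)^2}{6h}\Big)dx+\frac\tau2\,\overline\zeta^{\,2},\qquad\tau=P_0|\mathcal E_+|.$$ Remainder: $R(\zeta,q)=\frac{(\partial_xq)^3}{6h^2}+\frac{q\,\partial_x\zeta\,\partial_t\partial_xq}{3h^2}$. *)

theory Defs
  imports "HOL-Analysis.Analysis"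
begin

text \<open>
  A field is a function \<open>u t x\<close> of time \<open>t \<in> [0,T)\<close> and of \<open>x \<in> (-\<infinity>,l)\<close>. Its values at the
  contact points \<open>x = \<plusminus>r\<close> are irrelevant; only the one-sided traces there are used.
\<close>

definition Int_dom :: "real \<Rightarrow> real set" where
  "Int_dom r = {-r<..<r}"

definition Ext_minus :: "real \<Rightarrow> real set" where
  "Ext_minus r = {..< -r}"

definition Ext_plus :: "real \<Rightarrow> real \<Rightarrow> real set" where
  "Ext_plus r l = {r<..<l}"

definition Ext :: "real \<Rightarrow> real \<Rightarrow> real set" where
  "Ext r l = Ext_minus r \<union> Ext_plus r l"

text \<open>The value at \<open>x\<close> of the restriction of \<open>f\<close> to \<open>D\<close>.\<close>

definition bdry_trace :: "real set \<Rightarrow> (real \<Rightarrow> real) \<Rightarrow> real \<Rightarrow> real" where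
  "bdry_trace D f x = Lim (at x within D) f"

text \<open>The time derivative is one-sided at \<open>t = 0\<close>.\<close>

definition dt :: "real \<Rightarrow> (real \<Rightarrow> real \<Rightarrow> real) \<Rightarrow> real \<Rightarrow> real \<Rightarrow> real" where
  "dt T u t x = vector_derivative (\<lambda>s. u s x) (at t within {0..<T})"

definition dx :: "(real \<Rightarrow> real \<Rightarrow> real) \<Rightarrow> real \<Rightarrow> real \<Rightarrow> real" where
  "dx u t x = deriv (u t) x"

text \<open>\<open>u\<close> is of class \<open>C\<^sup>k\<close> on \<open>[0,T) \<times> D\<close> (\<open>D\<close> open), and all its derivatives of order at
  most \<open>k\<close> extend continuously to \<open>[0,T) \<times> closure D\<close>.\<close>

fun Ck_closure :: "nat \<Rightarrow> real \<Rightarrow> real set \<Rightarrow> (real \<Rightarrow> real \<Rightarrow> real) \<Rightarrow> bool" where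
  "Ck_closure 0 T D u \<longleftrightarrow>
     (\<exists>v. continuous_on ({0..<T} \<times> closure D) (\<lambda>(t, x). v t x) \<and>
          (\<forall>t\<in>{0..<T}. \<forall>x\<in>D. u t x = v t x))"
| "Ck_closure (Suc k) T D u \<longleftrightarrow>
     Ck_closure 0 T D u \<and>
     (\<forall>t\<in>{0..<T}. \<forall>x\<in>D. (\<lambda>s. u s x) differentiable (at t within {0..<T}) \<and>
                             u t differentiable (at x)) \<and>
     Ck_closure k T D (dt T u) \<and> Ck_closure k T D (dx u)"

text \<open>All derivatives of \<open>u\<close> of order at most \<open>k\<close> are dominated on \<open>D\<close>, locally uniformly in time, by
  a square-integrable function of \<open>x\<close> vanishing at \<open>-\<infinity>\<close>.\<close>

fun decaying :: "nat \<Rightarrow> real \<Rightarrow> real set \<Rightarrow> (real \<Rightarrow> real \<Rightarrow> real) \<Rightarrow> bool" where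
  "decaying 0 T D u \<longleftrightarrow>
     (\<forall>K. compact K \<and> K \<subseteq> {0..<T} \<longrightarrow>
        (\<exists>g. set_integrable lborel D (\<lambda>x. (g x)\<^sup>2) \<and> (g \<longlongrightarrow> 0) at_bot \<and>
             (\<forall>t\<in>K. \<forall>x\<in>D. \<bar>u t x\<bar> \<le> g x)))"
| "decaying (Suc k) T D u \<longleftrightarrow>
     decaying 0 T D u \<and> decaying k T D (dt T u) \<and> decaying k T D (dx u)"

text \<open>The orders are those of the derivatives occurring in the equations: first order for \<open>\<zeta>\<close> and
  \<open>P\<close>, third order (through \<open>\<partial>\<^sub>x\<^sup>2\<partial>\<^sub>t q\<close>) for \<open>q\<close>. As \<open>P\<close> vanishes on the left exterior
  domain, no decay has to be required of it.\<close>

definition regular ::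
  "real \<Rightarrow> real \<Rightarrow> real \<Rightarrow> (real \<Rightarrow> real \<Rightarrow> real) \<Rightarrow> (real \<Rightarrow> real \<Rightarrow> real) \<Rightarrow> (real \<Rightarrow> real \<Rightarrow> real) \<Rightarrow> bool"
where
  "regular r l T \<zeta> q P \<longleftrightarrow>
     (\<forall>D\<in>{Ext_minus r, Int_dom r, Ext_plus r l}.
        Ck_closure 1 T D \<zeta> \<and> Ck_closure 3 T D q \<and> Ck_closure 1 T D P) \<and>
     decaying 1 T (Ext_minus r) \<zeta> \<and> decaying 3 T (Ext_minus r) q"

definition height :: "real \<Rightarrow> (real \<Rightarrow> real \<Rightarrow> real) \<Rightarrow> real \<Rightarrow> real \<Rightarrow> real" where
  "height \<epsilon> \<zeta> t x = 1 + \<epsilon> * \<zeta> t x"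

definition mean_plus :: "real \<Rightarrow> real \<Rightarrow> (real \<Rightarrow> real) \<Rightarrow> real" where
  "mean_plus r l z = 1 / (l - r) * (LINT x:Ext_plus r l|lborel. z x)"

definition memory :: "real \<Rightarrow> (real \<Rightarrow> real) \<Rightarrow> real \<Rightarrow> real" where
  "memory \<kappa> f t = (LINT s:{0..t}|lborel. exp (- \<kappa> * (t - s)) * f s)"

text \<open>The quantity \<open>P\<^sub>0 (I - \<kappa> \<D>)\<close> applied to the mean elevation in the chamber.\<close>

definition chamber_term ::
  "real \<Rightarrow> real \<Rightarrow> real \<Rightarrow> real \<Rightarrow> (real \<Rightarrow> real \<Rightarrow> real) \<Rightarrow> real \<Rightarrow> real"
where
  "chamber_term r l P0 \<kappa> \<zeta> t =
     P0 * (mean_plus r l (\<zeta> t) - \<kappa> * memory \<kappa> (\<lambda>s. mean_plus r l (\<zeta> s)) t)"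

text \<open>Positivity of the water height is required up to the boundary of each subdomain, in the sense
  of traces; inside an open subdomain the trace of a continuous function is its value. The last
  boundary condition is also a trace, since \<open>x = l\<close> is not in the domain of the fields.\<close>

definition constrained_sw_solution ::
  "real \<Rightarrow> real \<Rightarrow> real \<Rightarrow> real \<Rightarrow> real \<Rightarrow> real \<Rightarrow> real \<Rightarrow> real \<Rightarrow>
   (real \<Rightarrow> real \<Rightarrow> real) \<Rightarrow> (real \<Rightarrow> real \<Rightarrow> real) \<Rightarrow> (real \<Rightarrow> real \<Rightarrow> real) \<Rightarrow> bool"
where
  "constrained_sw_solution \<epsilon> \<mu> r l P0 \<kappa> \<zeta>w T \<zeta> q P \<longleftrightarrow>
     (\<forall>t\<in>{0..<T}.
       (\<forall>D\<in>{Ext_minus r, Int_dom r, Ext_plus r l}.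
          (\<forall>x\<in>closure D. 1 + \<epsilon> * bdry_trace D (\<zeta> t) x > 0) \<and>
          (\<forall>x\<in>D. dt T \<zeta> t x + dx q t x = 0 \<and>
             (dt T q t x - \<mu> / 3 * dx (dx (dt T q)) t x)
               + \<epsilon> * dx (\<lambda>t x. (q t x)\<^sup>2 / height \<epsilon> \<zeta> t x) t x
               + height \<epsilon> \<zeta> t x * dx \<zeta> t x
             = - (height \<epsilon> \<zeta> t x / \<epsilon>) * dx P t x)) \<and>
       (\<zeta> t \<longlongrightarrow> 0) at_bot \<and> (q t \<longlongrightarrow> 0) at_bot \<and>
       bdry_trace (Ext_plus r l) (q t) l = 0 \<and>
       (\<forall>x\<in>Int_dom r. \<zeta> t x = \<zeta>w) \<and>
       (\<forall>x\<in>Ext_minus r. P t x = 0) \<and>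
       (\<forall>x\<in>Ext_plus r l. P t x = \<epsilon> * chamber_term r l P0 \<kappa> \<zeta> t))"

text \<open>For a solution \<open>q\<close> does not depend on \<open>x\<close> in the interior domain (lemma
  \<open>interior_discharge\<close> below), so that \<open>q\<^sub>i\<close> can be read off at \<open>x = 0\<close>.\<close>

definition q_int :: "(real \<Rightarrow> real \<Rightarrow> real) \<Rightarrow> real \<Rightarrow> real" where
  "q_int q t = q t 0"

definition Bern_E ::
  "real \<Rightarrow> real \<Rightarrow> real \<Rightarrow> (real \<Rightarrow> real \<Rightarrow> real) \<Rightarrow> (real \<Rightarrow> real \<Rightarrow> real) \<Rightarrow> real \<Rightarrow> real \<Rightarrow> real"
where
  "Bern_E \<epsilon> \<mu> T \<zeta> q t x =
     \<epsilon> * (q t x)\<^sup>2 / (2 * (height \<epsilon> \<zeta> t x)\<^sup>2) - \<mu> * dx (dt T q) t x / (3 * height \<epsilon> \<zeta> t x)"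

definition E_tot ::
  "real \<Rightarrow> real \<Rightarrow> real \<Rightarrow> real \<Rightarrow> real \<Rightarrow> (real \<Rightarrow> real \<Rightarrow> real) \<Rightarrow> (real \<Rightarrow> real \<Rightarrow> real) \<Rightarrow> real \<Rightarrow> real"
where
  "E_tot \<epsilon> \<mu> r l P0 \<zeta> q t =
     (LINT x:{..<l}|lborel.
        (\<zeta> t x)\<^sup>2 / 2 + (q t x)\<^sup>2 / (2 * height \<epsilon> \<zeta> t x)
        + \<mu> * ((dx q t x)\<^sup>2 / (6 * height \<epsilon> \<zeta> t x)))
     + (P0 * (l - r)) / 2 * (mean_plus r l (\<zeta> t))\<^sup>2"

definition remainder ::
  "real \<Rightarrow> real \<Rightarrow> (real \<Rightarrow> real \<Rightarrow> real) \<Rightarrow> (real \<Rightarrow> real \<Rightarrow> real) \<Rightarrow> real \<Rightarrow> real \<Rightarrow> real"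
where
  "remainder \<epsilon> T \<zeta> q t x =
     (dx q t x) ^ 3 / (6 * (height \<epsilon> \<zeta> t x)\<^sup>2)
     + q t x * dx \<zeta> t x * dt T (dx q) t x / (3 * (height \<epsilon> \<zeta> t x)\<^sup>2)"

lemma interior_discharge:
  assumes reg: "regular r l T \<zeta> q P"
    and sol: "constrained_sw_solution \<epsilon> \<mu> r l P0 \<kappa> \<zeta>w T \<zeta> q P"
    and t: "t \<in> {0..<T}" and x: "x \<in> Int_dom r"
  shows "q t x = q_int q t"
proof -
  have nontriv: "at t within {0..<T} \<noteq> bot"
    using t by (simp add: trivial_limit_within)
  have zero: "dx q t y = 0" if y: "y \<in> Int_dom r" for y
  proof -
    have "((\<lambda>s. \<zeta> s y) has_vector_derivative 0) (at t within {0..<T})"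
    proof (rule has_vector_derivative_transform[OF t _ has_vector_derivative_const[of \<zeta>w]])
      show "\<zeta> s y = \<zeta>w" if "s \<in> {0..<T}" for s
        using sol y that unfolding constrained_sw_solution_def by blast
    qed
    then have "dt T \<zeta> t y = 0"
      unfolding dt_def by (rule vector_derivative_within[OF nontriv])
    moreover have "dt T \<zeta> t y + dx q t y = 0"
      using sol y t unfolding constrained_sw_solution_def by blast
    ultimately show ?thesis by simp
  qed
  have "(q t has_field_derivative 0) (at y)" if y: "y \<in> Int_dom r" for y
  proof -
    have "Ck_closure 3 T (Int_dom r) q"
      using reg unfolding regular_def by blast
    then have "q t differentiable (at y)"
      using t y unfolding numeral_3_eq_3 Ck_closure.simps(2) by blast
    then show ?thesis
      using zero[OF y] by (metis dx_def DERIV_deriv_iff_real_differentiable)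
  qed
  then have "q t constant_on Int_dom r"
    by (intro has_field_derivative_0_imp_constant_on) (auto simp: Int_dom_def)
  then show ?thesis
    using x by (auto simp: constant_on_def q_int_def Int_dom_def)
qed

end

theory Submission imports Defs begin

text \<open>
  The mass and momentum equations give the local balance
  \<open>\<partial>\<^sub>t e + \<partial>\<^sub>x (q (\<zeta> + P / \<epsilon> + \<EE>)) = \<epsilon> \<mu> R + \<partial>\<^sub>x q P / \<epsilon>\<close>, where \<open>e\<close> is the energy density and
  \<open>\<EE>\<close> is \<open>Bern_E\<close>. In the interior domain \<open>\<partial>\<^sub>x q = 0\<close>; in the exterior domains \<open>P\<close> does not depend
  on \<open>x\<close> and can be replaced by \<open>0\<close> in the flux. Integrating over the three domains leaves the flux
  jumps at \<open>x = \<plusminus>r\<close>, which the Bernoulli principles identify: they cancel at \<open>-r\<close>, and at \<open>r\<close>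
  they add up to \<open>- P\<^sub>0 q\<^sub>i\<close> times the mean elevation in the chamber. This is compensated by the
  last term of the total energy, because conservation of mass makes the mean elevation grow at the
  rate \<open>q\<^sub>i / (l - r)\<close>.
\<close>

declare Ck_closure.simps [simp del] decaying.simps [simp del]

section \<open>One-sided filters in time\<close>

text \<open>All bounds below are uniform only on compact intervals \<open>{0..t1}\<close> with
  \<open>t1 < T\<close>. A neighbourhood of \<open>t\<close> stays left of \<open>t1\<close>, so the
  filter, one-sided at \<open>t = 0\<close>, does not notice the cut.\<close>

lemma at_within_time:
  fixes t T t1 :: real
  assumes "t \<in> {0..<T}" "t < t1" "t1 < T"
  shows "at t within {0..<T} = at t within {0..t1}"
  by (rule at_within_nhd[of t "{..<t1}"]) (use assms in auto)

lemma at_within_time_nontrivial: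
  fixes t T :: real
  assumes "t \<in> {0..<T}"
  shows "at t within {0..<T} \<noteq> bot"
  using assms by (simp add: trivial_limit_within)

subsection \<open>Domination locally uniform in time\<close>

text \<open>The hypothesis of dominated convergence: one integrable majorant for all times of each
  compact \<open>{0..t1}\<close>. Continuity in \<open>x\<close> is carried along because on an open
  \<open>D\<close> it supplies measurability.\<close>

definition dominated :: "real \<Rightarrow> real set \<Rightarrow> (real \<Rightarrow> real \<Rightarrow> real) \<Rightarrow> bool" where
  "dominated T D u \<longleftrightarrow> (\<forall>t\<in>{0..<T}. continuous_on D (u t)) \<and>
     (\<forall>t1\<in>{0..<T}. \<exists>G. set_integrable lborel D G \<and> (\<forall>t\<in>{0..t1}. \<forall>x\<in>D. \<bar>u t x\<bar> \<le> G x))"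

text \<open>On the half line the decay hypothesis bounds the fields by square-integrable functions
  only, so they enter the integrals in pairs.\<close>

definition sq_dominated :: "real \<Rightarrow> real set \<Rightarrow> (real \<Rightarrow> real \<Rightarrow> real) \<Rightarrow> bool" where
  "sq_dominated T D u \<longleftrightarrow> (\<forall>t\<in>{0..<T}. continuous_on D (u t)) \<and> dominated T D (\<lambda>t x. (u t x)\<^sup>2)"

text \<open>The class of admissible multipliers: bounded in \<open>x\<close> on the whole of
  \<open>D\<close>, locally uniformly in time.\<close>

definition loc_bdd :: "real \<Rightarrow> real set \<Rightarrow> (real \<Rightarrow> real \<Rightarrow> real) \<Rightarrow> bool" where
  "loc_bdd T D u \<longleftrightarrow> (\<forall>t\<in>{0..<T}. continuous_on D (u t)) \<and>
     (\<forall>t1\<in>{0..<T}. \<exists>B. \<forall>t\<in>{0..t1}. \<forall>x\<in>D. \<bar>u t x\<bar> \<le> B)"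

lemma dominatedD:
  assumes "dominated T D u" "t1 \<in> {0..<T}"
  obtains G where "set_integrable lborel D G" "\<And>t x. t \<in> {0..t1} \<Longrightarrow> x \<in> D \<Longrightarrow> \<bar>u t x\<bar> \<le> G x"
  using assms unfolding dominated_def by blast

lemma loc_bddD:
  assumes "loc_bdd T D u" "t1 \<in> {0..<T}"
  obtains B where "B \<ge> 0" "\<And>t x. t \<in> {0..t1} \<Longrightarrow> x \<in> D \<Longrightarrow> \<bar>u t x\<bar> \<le> B"
proof -
  obtain B where "\<forall>t\<in>{0..t1}. \<forall>x\<in>D. \<bar>u t x\<bar> \<le> B"
    using assms unfolding loc_bdd_def by blast
  \<comment> \<open>If \<open>D\<close> is empty, the given bound may be negative; it is raised to
    \<open>0\<close>.\<close>
  then show ?thesis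
    by (intro that[of "max B 0"]) (auto simp: le_max_iff_disj)
qed

lemma dominated_add:
  assumes u: "dominated T D u" and v: "dominated T D v"
  shows "dominated T D (\<lambda>t x. u t x + v t x)"
  unfolding dominated_def
proof (intro conjI ballI)
  show "continuous_on D (\<lambda>x. u t x + v t x)" if "t \<in> {0..<T}" for t
    using u v that unfolding dominated_def by (intro continuous_on_add) auto
  fix t1 assume t1: "t1 \<in> {0..<T}"
  obtain G where G: "set_integrable lborel D G" "\<And>t x. t \<in> {0..t1} \<Longrightarrow> x \<in> D \<Longrightarrow> \<bar>u t x\<bar> \<le> G x"
    using dominatedD[OF u t1] by blast
  obtain H where H: "set_integrable lborel D H" "\<And>t x. t \<in> {0..t1} \<Longrightarrow> x \<in> D \<Longrightarrow> \<bar>v t x\<bar> \<le> H x"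
    using dominatedD[OF v t1] by blast
  show "\<exists>K. set_integrable lborel D K \<and> (\<forall>t\<in>{0..t1}. \<forall>x\<in>D. \<bar>u t x + v t x\<bar> \<le> K x)"
    using G H by (intro exI[of _ "\<lambda>x. G x + H x"]) (fastforce intro!: set_integral_add(1))
qed

lemma dominated_cmult:
  assumes u: "dominated T D u"
  shows "dominated T D (\<lambda>t x. c * u t x)"
  unfolding dominated_def
proof (intro conjI ballI)
  show "continuous_on D (\<lambda>x. c * u t x)" if "t \<in> {0..<T}" for t
    using u that unfolding dominated_def by (intro continuous_on_mult) auto
  fix t1 assume t1: "t1 \<in> {0..<T}"
  obtain G where G: "set_integrable lborel D G" "\<And>t x. t \<in> {0..t1} \<Longrightarrow> x \<in> D \<Longrightarrow> \<bar>u t x\<bar> \<le> G x"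
    using dominatedD[OF u t1] by blast
  show "\<exists>K. set_integrable lborel D K \<and> (\<forall>t\<in>{0..t1}. \<forall>x\<in>D. \<bar>c * u t x\<bar> \<le> K x)"
    using G by (intro exI[of _ "\<lambda>x. \<bar>c\<bar> * G x"]) (auto simp: abs_mult mult_left_mono)
qed

lemma dominated_diff:
  assumes u: "dominated T D u" and v: "dominated T D v"
  shows "dominated T D (\<lambda>t x. u t x - v t x)"
  using dominated_add[OF u dominated_cmult[OF v, of "-1"]] by simp

lemma dominated_mult_bdd:
  assumes u: "dominated T D u" and v: "loc_bdd T D v"
  shows "dominated T D (\<lambda>t x. u t x * v t x)"
  unfolding dominated_def
proof (intro conjI ballI)
  show "continuous_on D (\<lambda>x. u t x * v t x)" if "t \<in> {0..<T}" for t
    using u v that unfolding dominated_def loc_bdd_def by (intro continuous_on_mult) auto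
  fix t1 assume t1: "t1 \<in> {0..<T}"
  obtain G where G: "set_integrable lborel D G" "\<And>t x. t \<in> {0..t1} \<Longrightarrow> x \<in> D \<Longrightarrow> \<bar>u t x\<bar> \<le> G x"
    using dominatedD[OF u t1] by blast
  obtain B where B: "B \<ge> 0" "\<And>t x. t \<in> {0..t1} \<Longrightarrow> x \<in> D \<Longrightarrow> \<bar>v t x\<bar> \<le> B"
    using loc_bddD[OF v t1] by blast
  have "\<bar>u t x * v t x\<bar> \<le> G x * B" if "t \<in> {0..t1}" "x \<in> D" for t x
    unfolding abs_mult using G(2)[OF that] B that by (intro mult_mono) auto
  then show "\<exists>K. set_integrable lborel D K \<and> (\<forall>t\<in>{0..t1}. \<forall>x\<in>D. \<bar>u t x * v t x\<bar> \<le> K x)"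
    using G(1) by (intro exI[of _ "\<lambda>x. G x * B"]) auto
qed

text \<open>Since \<open>2 * \<bar>u * v\<bar> \<le> u\<^sup>2 + v\<^sup>2\<close>, the majorants of
  the two squares add up to a majorant of the product, again independent of time on
  \<open>{0..t1}\<close>.\<close>

lemma dominated_mult:
  assumes u: "sq_dominated T D u" and v: "sq_dominated T D v"
  shows "dominated T D (\<lambda>t x. u t x * v t x)"
  unfolding dominated_def
proof (intro conjI ballI)
  show "continuous_on D (\<lambda>x. u t x * v t x)" if "t \<in> {0..<T}" for t
    using u v that unfolding sq_dominated_def by (intro continuous_on_mult) auto
  fix t1 assume t1: "t1 \<in> {0..<T}"
  have u': "dominated T D (\<lambda>t x. (u t x)\<^sup>2)" and v': "dominated T D (\<lambda>t x. (v t x)\<^sup>2)"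
    using u v unfolding sq_dominated_def by auto
  obtain G where G: "set_integrable lborel D G" "\<And>t x. t \<in> {0..t1} \<Longrightarrow> x \<in> D \<Longrightarrow> \<bar>(u t x)\<^sup>2\<bar> \<le> G x"
    using dominatedD[OF u' t1] by blast
  obtain H where H: "set_integrable lborel D H" "\<And>t x. t \<in> {0..t1} \<Longrightarrow> x \<in> D \<Longrightarrow> \<bar>(v t x)\<^sup>2\<bar> \<le> H x"
    using dominatedD[OF v' t1] by blast
  have "\<bar>u t x * v t x\<bar> \<le> G x + H x" if "t \<in> {0..t1}" "x \<in> D" for t x
  proof -
    have "2 * (\<bar>u t x\<bar> * \<bar>v t x\<bar>) \<le> (u t x)\<^sup>2 + (v t x)\<^sup>2"
      using sum_squares_bound[of "\<bar>u t x\<bar>" "\<bar>v t x\<bar>"] by simp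
    moreover have "0 \<le> \<bar>u t x\<bar> * \<bar>v t x\<bar>" by simp
    ultimately show ?thesis
      using G(2)[OF that] H(2)[OF that] unfolding abs_mult abs_power2 by linarith
  qed
  then show "\<exists>K. set_integrable lborel D K \<and> (\<forall>t\<in>{0..t1}. \<forall>x\<in>D. \<bar>u t x * v t x\<bar> \<le> K x)"
    using G(1) H(1) by (intro exI[of _ "\<lambda>x. G x + H x"]) (auto intro!: set_integral_add(1))
qed

lemma loc_bdd_mult:
  assumes u: "loc_bdd T D u" and v: "loc_bdd T D v"
  shows "loc_bdd T D (\<lambda>t x. u t x * v t x)"
  unfolding loc_bdd_def
proof (intro conjI ballI)
  show "continuous_on D (\<lambda>x. u t x * v t x)" if "t \<in> {0..<T}" for t
    using u v that unfolding loc_bdd_def by (intro continuous_on_mult) auto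
  fix t1 assume t1: "t1 \<in> {0..<T}"
  obtain A where A: "A \<ge> 0" "\<And>t x. t \<in> {0..t1} \<Longrightarrow> x \<in> D \<Longrightarrow> \<bar>u t x\<bar> \<le> A"
    using loc_bddD[OF u t1] by blast
  obtain B where B: "B \<ge> 0" "\<And>t x. t \<in> {0..t1} \<Longrightarrow> x \<in> D \<Longrightarrow> \<bar>v t x\<bar> \<le> B"
    using loc_bddD[OF v t1] by blast
  show "\<exists>C. \<forall>t\<in>{0..t1}. \<forall>x\<in>D. \<bar>u t x * v t x\<bar> \<le> C"
    using A B by (intro exI[of _ "A * B"]) (auto simp: abs_mult intro!: mult_mono)
qed

lemma dominated_integrable:
  assumes u: "dominated T D u" and t: "t \<in> {0..<T}" and D: "open D"
  shows "set_integrable lborel D (u t)"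
proof -
  obtain G where G: "set_integrable lborel D G" "\<And>s x. s \<in> {0..t} \<Longrightarrow> x \<in> D \<Longrightarrow> \<bar>u s x\<bar> \<le> G x"
    using dominatedD[OF u t] by blast
  have "continuous_on D (u t)" using u t unfolding dominated_def by auto
  then have "(\<lambda>x. indicator D x *\<^sub>R u t x) \<in> borel_measurable borel"
    using D by (intro borel_measurable_continuous_on_indicator) auto
  then have "set_borel_measurable lborel D (u t)"
    unfolding set_borel_measurable_def by simp
  moreover have "\<bar>u t x\<bar> \<le> \<bar>G x\<bar>" if "x \<in> D" for x
    using G(2)[of t x] that t by auto
  ultimately show ?thesis
    using G(1) by (intro set_integrable_bound[OF G(1)]) auto
qed

section \<open>Differentiation under the integral sign\<close>

text \<open>The difference quotients converge pointwise, and the mean value inequality bounds them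
  by the majorant of \<open>u'\<close>. This covers the one-sided derivative at \<open>t = 0\<close>
  as well.\<close>

lemma has_real_derivative_integral:
  assumes D: "open D" and t: "t \<in> {0..<T}"
    and u: "dominated T D u" and u': "dominated T D u'"
    and der: "\<And>s x. s \<in> {0..<T} \<Longrightarrow> x \<in> D \<Longrightarrow>
        ((\<lambda>s. u s x) has_real_derivative u' s x) (at s within {0..<T})"
  shows "((\<lambda>s. LINT x:D|lborel. u s x) has_real_derivative (LINT x:D|lborel. u' t x))
           (at t within {0..<T})"
proof -
  \<comment> \<open>Any time strictly between \<open>t\<close> and \<open>T\<close> serves; the
    majorant of \<open>u'\<close> is taken on \<open>{0..t1}\<close>.\<close>
  define t1 where "t1 = (t + T) / 2"
  have t1: "t < t1" "t1 < T" "t1 \<in> {0..<T}" using t by (auto simp: t1_def)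
  obtain G where G: "set_integrable lborel D G" "\<And>s x. s \<in> {0..t1} \<Longrightarrow> x \<in> D \<Longrightarrow> \<bar>u' s x\<bar> \<le> G x"
    using dominatedD[OF u' t1(3)] by blast
  have int: "set_integrable lborel D (u s)" if "s \<in> {0..<T}" for s
    by (rule dominated_integrable[OF u that D])
  have int': "set_integrable lborel D (u' t)"
    by (rule dominated_integrable[OF u' t D])
  show ?thesis
    unfolding has_field_derivative_iff at_within_time[OF t t1(1,2)] tendsto_at_iff_sequentially comp_def
  proof (intro allI impI)
    fix X :: "nat \<Rightarrow> real"
    assume X: "\<forall>i. X i \<in> {0..t1} - {t}" and lim: "X \<longlonglongrightarrow> t"
    have XT: "X i \<in> {0..<T}" for i using X[rule_format, of i] t1 by auto
    define Q where "Q = (\<lambda>i x. (u (X i) x - u t x) / (X i - t))"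
    have Qint: "set_integrable lborel D (Q i)" for i
      unfolding Q_def using int[OF XT] int[OF t] by (intro set_integrable_divide set_integral_diff(1))
    have "(\<lambda>i. LINT x|lborel. indicator D x *\<^sub>R Q i x) \<longlonglongrightarrow> (LINT x|lborel. indicator D x *\<^sub>R u' t x)"
    proof (rule integral_dominated_convergence[where w = "\<lambda>x. indicator D x *\<^sub>R G x"])
      show "(\<lambda>x. indicator D x *\<^sub>R u' t x) \<in> borel_measurable lborel"
        using int' unfolding set_integrable_def by (rule borel_measurable_integrable)
      show "(\<lambda>x. indicator D x *\<^sub>R Q i x) \<in> borel_measurable lborel" for i
        using Qint[of i] unfolding set_integrable_def by (rule borel_measurable_integrable)
      show "integrable lborel (\<lambda>x. indicator D x *\<^sub>R G x)"
        using G(1) unfolding set_integrable_def .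
      have "(\<lambda>i. Q i x) \<longlonglongrightarrow> u' t x" if "x \<in> D" for x
      proof -
        have "((\<lambda>s. (u s x - u t x) / (s - t)) \<longlongrightarrow> u' t x) (at t within {0..t1})"
          using der[OF t that]
          unfolding has_field_derivative_iff at_within_time[OF t t1(1,2)] .
        then show ?thesis
          unfolding tendsto_at_iff_sequentially Q_def comp_def using X lim by blast
      qed
      then show "AE x in lborel. (\<lambda>i. indicator D x *\<^sub>R Q i x) \<longlonglongrightarrow> indicator D x *\<^sub>R u' t x"
        by (intro AE_I2) (auto split: split_indicator)
      \<comment> \<open>The interval \<open>{0..t1}\<close> is convex and contains both
        \<open>X i\<close> and \<open>t\<close>, so the bound on \<open>u'\<close> passes to the
        quotient.\<close>
      have "\<bar>Q i x\<bar> \<le> G x" if x: "x \<in> D" for i x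
      proof -
        have "norm (u (X i) x - u t x) \<le> G x * norm (X i - t)"
        proof (rule field_differentiable_bound[where S = "{0..t1}" and f' = "\<lambda>s. u' s x"])
          show "((\<lambda>s. u s x) has_field_derivative u' s x) (at s within {0..t1})" if "s \<in> {0..t1}" for s
            using that t1 by (intro DERIV_subset[OF der]) (use x in auto)
        qed (use X t t1 G(2) x in auto)
        moreover have "X i \<noteq> t" using X by auto
        ultimately show ?thesis by (simp add: Q_def divide_le_eq)
      qed
      then show "AE x in lborel. norm (indicator D x *\<^sub>R Q i x) \<le> indicator D x *\<^sub>R G x" for i
        by (intro AE_I2) (auto split: split_indicator)
    qed
    moreover have "(LINT x|lborel. indicator D x *\<^sub>R Q i x)
        = ((LINT x:D|lborel. u (X i) x) - (LINT x:D|lborel. u t x)) / (X i - t)" for i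
      unfolding set_lebesgue_integral_def[symmetric] Q_def
      using int[OF XT] int[OF t] by (simp add: set_integral_diff)
    ultimately show "(\<lambda>i. ((LINT x:D|lborel. u (X i) x) - (LINT x:D|lborel. u t x)) / (X i - t))
        \<longlonglongrightarrow> (LINT x:D|lborel. u' t x)"
      unfolding set_lebesgue_integral_def by simp
  qed
qed

subsection \<open>Regularity up to the boundary\<close>

lemma Ck_closure_0:
  assumes "Ck_closure k T D u"
  shows "Ck_closure 0 T D u"
  using assms by (cases k) (simp_all only: Ck_closure.simps(2))

lemma Ck_closure_dt: "Ck_closure (Suc k) T D u \<Longrightarrow> Ck_closure k T D (dt T u)"
  and Ck_closure_dx: "Ck_closure (Suc k) T D u \<Longrightarrow> Ck_closure k T D (dx u)"
  by (simp_all only: Ck_closure.simps(2))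

lemma has_derivative_dt:
  assumes "Ck_closure (Suc k) T D u" "t \<in> {0..<T}" "x \<in> D"
  shows "((\<lambda>s. u s x) has_real_derivative dt T u t x) (at t within {0..<T})"
proof -
  have "(\<lambda>s. u s x) differentiable (at t within {0..<T})"
    using assms unfolding Ck_closure.simps(2) by blast
  then show ?thesis
    unfolding dt_def has_real_derivative_iff_has_vector_derivative vector_derivative_works .
qed

lemma has_derivative_dx:
  assumes "Ck_closure (Suc k) T D u" "t \<in> {0..<T}" "x \<in> D"
  shows "(u t has_real_derivative dx u t x) (at x)"
proof -
  have "u t differentiable (at x)"
    using assms unfolding Ck_closure.simps(2) by blast
  then show ?thesis
    unfolding dx_def DERIV_deriv_iff_real_differentiable .
qed

lemma Ck_closure_0_continuous_on:
  assumes "Ck_closure 0 T D u"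
  shows "continuous_on ({0..<T} \<times> D) (\<lambda>(t, x). u t x)"
proof -
  obtain v where v: "continuous_on ({0..<T} \<times> closure D) (\<lambda>(t, x). v t x)"
    and eq: "\<forall>t\<in>{0..<T}. \<forall>x\<in>D. u t x = v t x"
    using assms unfolding Ck_closure.simps(1) by blast
  have "continuous_on ({0..<T} \<times> D) (\<lambda>(t, x). v t x)"
    by (rule continuous_on_subset[OF v]) (use closure_subset in auto)
  then show ?thesis
    by (rule continuous_on_eq) (use eq in auto)
qed

lemma Ck_closure_0_continuous_space:
  assumes "Ck_closure 0 T D u" "t \<in> {0..<T}"
  shows "continuous_on D (u t)"
proof -
  have "continuous_on D (\<lambda>x. (\<lambda>(t, x). u t x) (t, x))"
    by (rule continuous_on_compose2[OF Ck_closure_0_continuous_on[OF assms(1)]])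
       (use assms(2) in \<open>auto intro!: continuous_intros\<close>)
  then show ?thesis by simp
qed

text \<open>
  Schwarz's theorem; the time derivative may be one-sided. Differentiate
  \<open>u t y - u t a = \<integral>\<^sub>a\<^sup>y \<partial>\<^sub>x u\<close> first in \<open>t\<close>, under the integral, and then in \<open>y\<close>.
\<close>

lemma dt_dx_commute:
  assumes C: "Ck_closure (Suc (Suc k)) T D u" and D: "open D" and t: "t \<in> {0..<T}" and x: "x \<in> D"
  shows "dt T (dx u) t x = dx (dt T u) t x"
proof -
  have C0: "Ck_closure 0 T D (dt T (dx u))" and Cx: "Ck_closure (Suc k) T D (dx u)"
    and Ct: "Ck_closure (Suc k) T D (dt T u)"
    using C by (meson Ck_closure_dt Ck_closure_dx Ck_closure_0)+
  have Cx0: "Ck_closure 0 T D (dx u)" using Cx by (rule Ck_closure_0)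
  obtain d where d: "d > 0" "cball x d \<subseteq> D"
    using D x open_contains_cball by blast
  define a b where "a = x - d" and "b = x + d"
  have ab: "a < x" "x < b" "{a..b} \<subseteq> D"
    using d by (auto simp: a_def b_def cball_eq_atLeastAtMost)
  have dtu: "dt T u t y = dt T u t a + integral {a..y} (dt T (dx u) t)" if y: "y \<in> {a..b}" for y
  proof -
    have yD: "z \<in> D" if "z \<in> {a..y}" for z
      using that y ab(3) by auto
    have eq: "integral {a..y} (dx u s) = u s y - u s a" if s: "s \<in> {0..<T}" for s
    proof (rule integral_unique, rule fundamental_theorem_of_calculus)
      show "(u s has_vector_derivative dx u s z) (at z within {a..y})" if "z \<in> {a..y}" for z
      proof -
        from has_derivative_dx[OF C s yD[OF that]] show ?thesis
          unfolding has_real_derivative_iff_has_vector_derivative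
          by (rule has_vector_derivative_at_within)
      qed
    qed (use y in auto)
    have "((\<lambda>s. integral (cbox a y) (dx u s)) has_real_derivative integral (cbox a y) (dt T (dx u) t))
            (at t within {0..<T})"
    proof (rule leibniz_rule_field_derivative)
      show "((\<lambda>s. dx u s z) has_real_derivative dt T (dx u) s z) (at s within {0..<T})"
        if "s \<in> {0..<T}" "z \<in> cbox a y" for s z
        using has_derivative_dt[OF Cx that(1) yD] that(2) by simp
      show "dx u s integrable_on cbox a y" if "s \<in> {0..<T}" for s
        using continuous_on_subset[OF Ck_closure_0_continuous_space[OF Cx0 that], of "{a..y}"] yD
        by (simp add: integrable_continuous_real subset_eq)
      show "continuous_on ({0..<T} \<times> cbox a y) (\<lambda>(s, z). dt T (dx u) s z)"
        by (rule continuous_on_subset[OF Ck_closure_0_continuous_on[OF C0]]) (use yD in auto)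
    qed (use t in auto)
    then have "((\<lambda>s. u s y - u s a) has_real_derivative integral {a..y} (dt T (dx u) t))
            (at t within {0..<T})"
      using t eq by (auto elim!: has_field_derivative_transform_within[where d = 1])
    moreover have "((\<lambda>s. u s y - u s a) has_real_derivative dt T u t y - dt T u t a)
            (at t within {0..<T})"
      using y by (intro DERIV_diff has_derivative_dt[OF C t] yD) auto
    \<comment> \<open>Two derivatives of the same function of time, one by the Leibniz rule and one
      taken directly. They agree because the filter at \<open>t\<close>, possibly one-sided, is
      nontrivial.\<close>
    ultimately have "integral {a..y} (dt T (dx u) t) = dt T u t y - dt T u t a"
      by (rule has_field_derivative_unique[OF _ _ at_within_time_nontrivial[OF t]])
    then show ?thesis by simp
  qed
  have "((\<lambda>y. dt T u t a + integral {a..y} (dt T (dx u) t)) has_real_derivative dt T (dx u) t x)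
          (at x within {a..b})"
    using continuous_on_subset[OF Ck_closure_0_continuous_space[OF C0 t] ab(3)] ab
    by (auto intro!: derivative_eq_intros integral_has_real_derivative)
  then have "(dt T u t has_real_derivative dt T (dx u) t x) (at x within {a..b})"
    by (rule has_field_derivative_transform_within[where d = 1, OF _ zero_less_one])
       (use ab in \<open>auto simp: dtu[symmetric]\<close>)
  moreover have "at x within {a..b} = at x"
    using ab by (intro at_within_interior) auto
  ultimately have "(dt T u t has_real_derivative dt T (dx u) t x) (at x)" by simp
  then show ?thesis
    using DERIV_unique[OF has_derivative_dx[OF Ct t x]] by simp
qed

section \<open>Traces as values of a continuous extension\<close>

text \<open>\<open>Lim\<close> is determined only along a nontrivial filter. Points of an open set
  and the remaining points of its closure are all accumulation points.\<close>

lemma open_not_trivial_limit_closure: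
  fixes D :: "real set"
  assumes "open D" "x \<in> closure D"
  shows "at x within D \<noteq> bot"
proof -
  have "x islimpt D"
  proof (cases "x \<in> D")
    case True
    then show ?thesis using assms(1) by (intro interior_limit_point) (simp add: interior_open)
  next
    case False
    then show ?thesis using assms(2) by (simp add: closure_def)
  qed
  then show ?thesis by (simp add: trivial_limit_within)
qed

text \<open>The slice \<open>v t\<close> is continuous on \<open>closure D\<close> and agrees with
  \<open>u t\<close> on \<open>D\<close>, so its value is the limit from inside.\<close>

lemma bdry_trace_eq_extension:
  assumes v: "continuous_on ({0..<T} \<times> closure D) (\<lambda>(t, x). v t x)"
    and eq: "\<And>t x. t \<in> {0..<T} \<Longrightarrow> x \<in> D \<Longrightarrow> u t x = v t x"
    and D: "open D" and t: "t \<in> {0..<T}" and x: "x \<in> closure D"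
  shows "(u t \<longlongrightarrow> v t x) (at x within D)" "bdry_trace D (u t) x = v t x"
proof -
  have "continuous_on (closure D) (\<lambda>x. (\<lambda>(t, x). v t x) (t, x))"
    by (rule continuous_on_compose2[OF v]) (use t in \<open>auto intro!: continuous_intros\<close>)
  then have "(v t \<longlongrightarrow> v t x) (at x within closure D)"
    using x by (simp add: continuous_on_def)
  then have "(v t \<longlongrightarrow> v t x) (at x within D)"
    by (rule tendsto_within_subset) (rule closure_subset)
  moreover have "eventually (\<lambda>y. v t y = u t y) (at x within D)"
    using eq[OF t] by (auto simp: eventually_at_filter)
  ultimately show lim: "(u t \<longlongrightarrow> v t x) (at x within D)"
    by (rule Lim_transform_eventually)
  then show "bdry_trace D (u t) x = v t x"
    unfolding bdry_trace_def by (rule tendsto_Lim[OF open_not_trivial_limit_closure[OF D x]])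
qed

lemma bdry_trace_tendsto:
  assumes "Ck_closure 0 T D u" "open D" "t \<in> {0..<T}" "x \<in> closure D"
  shows "(u t \<longlongrightarrow> bdry_trace D (u t) x) (at x within D)"
proof -
  obtain v where v: "continuous_on ({0..<T} \<times> closure D) (\<lambda>(t, x). v t x)"
    and eq: "\<And>t x. t \<in> {0..<T} \<Longrightarrow> x \<in> D \<Longrightarrow> u t x = v t x"
    using assms(1) unfolding Ck_closure.simps(1) by blast
  show ?thesis
    using bdry_trace_eq_extension[OF v eq assms(2-4)] by simp
qed

section \<open>Boundedness and integrability from regularity and decay\<close>

text \<open>On the compact set \<open>{0..t1} \<times> (S \<inter> closure D)\<close> the extension
  is bounded; outside \<open>S\<close> a bound is assumed. A bounded domain takes
  \<open>S = closure D\<close>, where nothing is left outside; a half line takes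
  \<open>S = {M..c}\<close>.\<close>

lemma loc_bdd_extension:
  assumes v: "continuous_on ({0..<T} \<times> closure D) (\<lambda>(t, x). v t x)"
    and eq: "\<And>t x. t \<in> {0..<T} \<Longrightarrow> x \<in> D \<Longrightarrow> u t x = v t x"
    and bdd: "\<And>t1. t1 \<in> {0..<T} \<Longrightarrow>
        \<exists>S B. compact S \<and> (\<forall>t\<in>{0..t1}. \<forall>x\<in>D - S. \<bar>u t x\<bar> \<le> B)"
  shows "loc_bdd T D u"
  unfolding loc_bdd_def
proof (intro conjI ballI)
  have C: "Ck_closure 0 T D u" using v eq unfolding Ck_closure.simps(1) by blast
  show "continuous_on D (u t)" if "t \<in> {0..<T}" for t
    by (rule Ck_closure_0_continuous_space[OF C that])
  fix t1 assume t1: "t1 \<in> {0..<T}"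
  then obtain S B where S: "compact S" and B: "\<forall>t\<in>{0..t1}. \<forall>x\<in>D - S. \<bar>u t x\<bar> \<le> B"
    using bdd by blast
  have "compact ((\<lambda>(t, x). v t x) ` ({0..t1} \<times> (S \<inter> closure D)))"
    using t1 S
    by (intro compact_continuous_image continuous_on_subset[OF v] compact_Times compact_Int_closed) auto
  from compact_imp_bounded[OF this] obtain A where A: "\<forall>y \<in> (\<lambda>(t, x). v t x) ` ({0..t1} \<times> (S \<inter> closure D)). \<bar>y\<bar> \<le> A"
    unfolding bounded_real by blast
  have "\<bar>u t x\<bar> \<le> max A B" if t: "t \<in> {0..t1}" and x: "x \<in> D" for t x
  proof (cases "x \<in> S")
    case True
    have "v t x \<in> (\<lambda>(t, x). v t x) ` ({0..t1} \<times> (S \<inter> closure D))"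
      using t x True closure_subset by (auto intro!: image_eqI[of _ _ "(t, x)"])
    then have "\<bar>v t x\<bar> \<le> A" using A by blast
    then show ?thesis using eq[of t x] t t1 x by auto
  next
    case False
    then have "\<bar>u t x\<bar> \<le> B" using B t x by blast
    then show ?thesis by simp
  qed
  then show "\<exists>B. \<forall>t\<in>{0..t1}. \<forall>x\<in>D. \<bar>u t x\<bar> \<le> B" by blast
qed

lemma loc_bdd_bounded:
  assumes "Ck_closure 0 T D u" "bounded D"
  shows "loc_bdd T D u"
proof -
  obtain v where v: "continuous_on ({0..<T} \<times> closure D) (\<lambda>(t, x). v t x)"
    and eq: "\<And>t x. t \<in> {0..<T} \<Longrightarrow> x \<in> D \<Longrightarrow> u t x = v t x"
    using assms(1) unfolding Ck_closure.simps(1) by blast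
  show ?thesis
  proof (rule loc_bdd_extension[OF v eq])
    show "\<exists>S B. compact S \<and> (\<forall>t\<in>{0..t1}. \<forall>x\<in>D - S. \<bar>u t x\<bar> \<le> B)" for t1
      using assms(2) closure_subset[of D]
      by (intro exI[of _ "closure D"] exI[of _ 0]) auto
  qed
qed

lemma dominated_bounded:
  assumes "loc_bdd T D u" "bounded D" "open D"
  shows "dominated T D u"
  unfolding dominated_def
proof (intro conjI ballI)
  show "continuous_on D (u t)" if "t \<in> {0..<T}" for t
    using assms(1) that unfolding loc_bdd_def by blast
  fix t1 assume "t1 \<in> {0..<T}"
  then obtain B where B: "\<And>t x. t \<in> {0..t1} \<Longrightarrow> x \<in> D \<Longrightarrow> \<bar>u t x\<bar> \<le> B"
    using loc_bddD[OF assms(1)] by metis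
  have "set_integrable lborel D (\<lambda>_. B)"
    unfolding set_integrable_def using assms(2,3) emeasure_bounded_finite[of D]
    by (intro integrable_scaleR_left integrable_real_indicator) auto
  then show "\<exists>G. set_integrable lborel D G \<and> (\<forall>t\<in>{0..t1}. \<forall>x\<in>D. \<bar>u t x\<bar> \<le> G x)"
    using B by blast
qed

lemma sq_dominated_bounded:
  assumes "loc_bdd T D u" "bounded D" "open D"
  shows "sq_dominated T D u"
  using assms dominated_bounded[OF loc_bdd_mult[OF assms(1,1)] assms(2,3)]
  unfolding sq_dominated_def power2_eq_square by (auto simp: loc_bdd_def)

lemma decaying_bound:
  assumes "decaying 0 T D u" "t1 \<in> {0..<T}"
  obtains g where "set_integrable lborel D (\<lambda>x. (g x)\<^sup>2)" "(g \<longlongrightarrow> 0) at_bot"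
    "\<And>t x. t \<in> {0..t1} \<Longrightarrow> x \<in> D \<Longrightarrow> \<bar>u t x\<bar> \<le> g x"
proof -
  have "compact {0..t1} \<and> {0..t1} \<subseteq> {0..<T}" using assms(2) by auto
  then show ?thesis using assms(1) that unfolding decaying.simps by metis
qed

text \<open>The exceptional set is written as a compact interval so that it can serve as
  \<open>S\<close> in \<open>loc_bdd_extension\<close> and
  \<open>inverse_height_bounded\<close>.\<close>

lemma decaying_small:
  assumes "decaying 0 T {..<c} u" "t1 \<in> {0..<T}" "\<delta> > 0"
  obtains M where "\<And>t x. t \<in> {0..t1} \<Longrightarrow> x \<in> {..<c} - {M..c} \<Longrightarrow> \<bar>u t x\<bar> \<le> \<delta>"
proof -
  obtain g where g: "(g \<longlongrightarrow> 0) at_bot" "\<And>t x. t \<in> {0..t1} \<Longrightarrow> x \<in> {..<c} \<Longrightarrow> \<bar>u t x\<bar> \<le> g x"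
    using decaying_bound[OF assms(1,2)] by metis
  have "eventually (\<lambda>x. g x < \<delta>) at_bot"
    using order_tendstoD(2)[OF g(1)] assms(3) by simp
  then obtain M where M: "\<And>x. x \<le> M \<Longrightarrow> g x < \<delta>"
    by (auto simp: eventually_at_bot_linorder)
  have "\<bar>u t x\<bar> \<le> \<delta>" if "t \<in> {0..t1}" "x \<in> {..<c} - {M..c}" for t x
    using g(2)[of t x] M[of x] that by auto
  then show ?thesis using that by blast
qed

lemma loc_bdd_decaying:
  assumes "Ck_closure 0 T {..<c} u" "decaying 0 T {..<c} u"
  shows "loc_bdd T {..<c} u"
proof -
  obtain v where v: "continuous_on ({0..<T} \<times> closure {..<c}) (\<lambda>(t, x). v t x)"
    and eq: "\<And>t x. t \<in> {0..<T} \<Longrightarrow> x \<in> {..<c} \<Longrightarrow> u t x = v t x"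
    using assms(1) unfolding Ck_closure.simps(1) by blast
  show ?thesis
  proof (rule loc_bdd_extension[OF v eq])
    fix t1 assume "t1 \<in> {0..<T}"
    then obtain M where "\<And>t x. t \<in> {0..t1} \<Longrightarrow> x \<in> {..<c} - {M..c} \<Longrightarrow> \<bar>u t x\<bar> \<le> 1"
      using decaying_small[OF assms(2) _ zero_less_one] by metis
    then show "\<exists>S B. compact S \<and> (\<forall>t\<in>{0..t1}. \<forall>x\<in>{..<c} - S. \<bar>u t x\<bar> \<le> B)"
      by (intro exI[of _ "{M..c}"] exI[of _ 1]) auto
  qed
qed

lemma sq_dominated_decaying:
  assumes "Ck_closure 0 T D u" "decaying 0 T D u"
  shows "sq_dominated T D u"
  unfolding sq_dominated_def dominated_def
proof (intro conjI ballI)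
  show cont: "continuous_on D (u t)" if "t \<in> {0..<T}" for t
    by (rule Ck_closure_0_continuous_space[OF assms(1) that])
  show "continuous_on D (\<lambda>x. (u t x)\<^sup>2)" if "t \<in> {0..<T}" for t
    by (intro continuous_on_power cont that)
  fix t1 assume "t1 \<in> {0..<T}"
  then obtain g where g: "set_integrable lborel D (\<lambda>x. (g x)\<^sup>2)"
    "\<And>t x. t \<in> {0..t1} \<Longrightarrow> x \<in> D \<Longrightarrow> \<bar>u t x\<bar> \<le> g x"
    using decaying_bound[OF assms(2)] by metis
  have "\<bar>(u t x)\<^sup>2\<bar> \<le> (g x)\<^sup>2" if "t \<in> {0..t1}" "x \<in> D" for t x
    using power_mono[OF g(2)[OF that], of 2] by simp
  then show "\<exists>G. set_integrable lborel D G \<and> (\<forall>t\<in>{0..t1}. \<forall>x\<in>D. \<bar>(u t x)\<^sup>2\<bar> \<le> G x)"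
    using g(1) by (intro exI[of _ "\<lambda>x. (g x)\<^sup>2"]) blast
qed

text \<open>Positivity of the traces makes \<open>1 / (1 + \<epsilon> * v t x)\<close> continuous up
  to \<open>closure D\<close>, hence bounded on compact sets; positivity on \<open>D\<close> alone
  would let the height tend to \<open>0\<close> at a contact point. Outside \<open>S\<close> the
  height is at least \<open>1 / 2\<close>.\<close>

lemma inverse_height_bounded:
  assumes C: "Ck_closure 0 T D \<zeta>" and D: "open D"
    and pos: "\<And>t x. t \<in> {0..<T} \<Longrightarrow> x \<in> closure D \<Longrightarrow> 1 + \<epsilon> * bdry_trace D (\<zeta> t) x > 0"
    and out: "\<And>t1. t1 \<in> {0..<T} \<Longrightarrow>
        \<exists>S. compact S \<and> (\<forall>t\<in>{0..t1}. \<forall>x\<in>D - S. \<bar>\<epsilon> * \<zeta> t x\<bar> \<le> 1 / 2)"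
  shows "loc_bdd T D (\<lambda>t x. 1 / height \<epsilon> \<zeta> t x)"
proof -
  obtain v where v: "continuous_on ({0..<T} \<times> closure D) (\<lambda>(t, x). v t x)"
    and eq: "\<And>t x. t \<in> {0..<T} \<Longrightarrow> x \<in> D \<Longrightarrow> \<zeta> t x = v t x"
    using C unfolding Ck_closure.simps(1) by blast
  have pos': "1 + \<epsilon> * v t x > 0" if "t \<in> {0..<T}" "x \<in> closure D" for t x
    using pos[OF that] bdry_trace_eq_extension(2)[OF v eq D that] by simp
  show ?thesis
  proof (rule loc_bdd_extension[where v = "\<lambda>t x. 1 / (1 + \<epsilon> * v t x)"])
    have "continuous_on ({0..<T} \<times> closure D) (\<lambda>p. 1 / (1 + \<epsilon> * (case p of (t, x) \<Rightarrow> v t x)))"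
      using pos' by (intro continuous_intros v) fastforce
    then show "continuous_on ({0..<T} \<times> closure D) (\<lambda>(t, x). 1 / (1 + \<epsilon> * v t x))"
      by (simp add: case_prod_unfold)
    show "1 / height \<epsilon> \<zeta> t x = 1 / (1 + \<epsilon> * v t x)" if "t \<in> {0..<T}" "x \<in> D" for t x
      using eq[OF that] by (simp add: height_def)
    fix t1 assume "t1 \<in> {0..<T}"
    then obtain S where S: "compact S" "\<forall>t\<in>{0..t1}. \<forall>x\<in>D - S. \<bar>\<epsilon> * \<zeta> t x\<bar> \<le> 1 / 2"
      using out by blast
    have "\<bar>1 / height \<epsilon> \<zeta> t x\<bar> \<le> 2" if "t \<in> {0..t1}" "x \<in> D - S" for t x
    proof -
      have "\<bar>\<epsilon> * \<zeta> t x\<bar> \<le> 1 / 2" using S(2) that by blast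
      then have "height \<epsilon> \<zeta> t x \<ge> 1 / 2" unfolding height_def by linarith
      then show ?thesis by (simp add: divide_le_eq)
    qed
    then show "\<exists>S B. compact S \<and> (\<forall>t\<in>{0..t1}. \<forall>x\<in>D - S. \<bar>1 / height \<epsilon> \<zeta> t x\<bar> \<le> B)"
      using S(1) by blast
  qed
qed

subsection \<open>Energy balance on a single domain\<close>

definition energy_density ::
  "real \<Rightarrow> real \<Rightarrow> (real \<Rightarrow> real \<Rightarrow> real) \<Rightarrow> (real \<Rightarrow> real \<Rightarrow> real) \<Rightarrow> real \<Rightarrow> real \<Rightarrow> real"
where
  "energy_density \<epsilon> \<mu> \<zeta> q t x = (\<zeta> t x)\<^sup>2 / 2 + (q t x)\<^sup>2 / (2 * height \<epsilon> \<zeta> t x)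
        + \<mu> * ((dx q t x)\<^sup>2 / (6 * height \<epsilon> \<zeta> t x))"

text \<open>
  The potential \<open>p\<close> of \<open>\<partial>\<^sub>x P\<close> is \<open>P\<close> itself in the interior domain and \<open>0\<close> in the exterior ones,
  so that \<open>\<partial>\<^sub>x q p = 0\<close> everywhere.
\<close>

definition energy_flux ::
  "real \<Rightarrow> real \<Rightarrow> real \<Rightarrow> (real \<Rightarrow> real \<Rightarrow> real) \<Rightarrow> (real \<Rightarrow> real \<Rightarrow> real) \<Rightarrow> (real \<Rightarrow> real) \<Rightarrow> real \<Rightarrow> real \<Rightarrow> real"
where
  "energy_flux \<epsilon> \<mu> T \<zeta> q p t x = q t x * (\<zeta> t x + p x / \<epsilon> + Bern_E \<epsilon> \<mu> T \<zeta> q t x)"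

text \<open>The ends \<open>a\<close>, \<open>b\<close> are extended reals so that the half line and
  the bounded intervals share one fundamental theorem of calculus. The locale collects the equations
  and the bounds that make the energy terms integrable; the conditions at the ends enter later, as
  limits of the flux.\<close>

locale sw_domain =
  fixes \<epsilon> \<mu> T :: real and a b :: ereal and \<zeta> q P :: "real \<Rightarrow> real \<Rightarrow> real" and D :: "real set"
  assumes D_def: "D = einterval a b"
    and eps: "0 < \<epsilon>"
    and ab: "a < b"
    and Ck_\<zeta>: "Ck_closure 1 T D \<zeta>"
    and Ck_q: "Ck_closure 3 T D q"
    and sq_\<zeta>: "sq_dominated T D \<zeta>" "sq_dominated T D (dt T \<zeta>)"
    and sq_q: "sq_dominated T D q" "sq_dominated T D (dt T q)"
      "sq_dominated T D (dx q)" "sq_dominated T D (dt T (dx q))"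
    and bdd: "loc_bdd T D (dx \<zeta>)" "loc_bdd T D q" "loc_bdd T D (dx q)"
    and bdd_h: "loc_bdd T D (\<lambda>t x. 1 / height \<epsilon> \<zeta> t x)"
    and pos: "\<And>t x. t \<in> {0..<T} \<Longrightarrow> x \<in> D \<Longrightarrow> height \<epsilon> \<zeta> t x > 0"
    and mass: "\<And>t x. t \<in> {0..<T} \<Longrightarrow> x \<in> D \<Longrightarrow> dt T \<zeta> t x + dx q t x = 0"
    and momentum: "\<And>t x. t \<in> {0..<T} \<Longrightarrow> x \<in> D \<Longrightarrow>
        (dt T q t x - \<mu> / 3 * dx (dx (dt T q)) t x)
          + \<epsilon> * dx (\<lambda>t x. (q t x)\<^sup>2 / height \<epsilon> \<zeta> t x) t x
          + height \<epsilon> \<zeta> t x * dx \<zeta> t x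
        = - (height \<epsilon> \<zeta> t x / \<epsilon>) * dx P t x"
begin

text \<open>The chain rule applied to \<open>energy_density\<close>, with
  \<open>\<partial>\<^sub>t h = \<epsilon> \<partial>\<^sub>t \<zeta>\<close>, before either
  equation of the model is used.\<close>

definition energy_dt :: "real \<Rightarrow> real \<Rightarrow> real" where
  "energy_dt t x = \<zeta> t x * dt T \<zeta> t x + q t x * dt T q t x / height \<epsilon> \<zeta> t x
     - \<epsilon> * (q t x)\<^sup>2 * dt T \<zeta> t x / (2 * (height \<epsilon> \<zeta> t x)\<^sup>2)
     + \<mu> * (dx q t x * dt T (dx q) t x / (3 * height \<epsilon> \<zeta> t x))
     - \<mu> * \<epsilon> * dt T \<zeta> t x * (dx q t x)\<^sup>2 / (6 * (height \<epsilon> \<zeta> t x)\<^sup>2)"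

lemma open_D: "open D"
  unfolding D_def by simp

lemma Ck_dtq: "Ck_closure 2 T D (dt T q)" and Ck_dxq: "Ck_closure 2 T D (dx q)"
  using Ck_q by (auto simp: eval_nat_numeral intro: Ck_closure_dt Ck_closure_dx)

lemma Ck_dxdtq: "Ck_closure 1 T D (dx (dt T q))"
  using Ck_dtq by (auto simp: eval_nat_numeral intro: Ck_closure_dx)

lemma dtdx_q:
  assumes "t \<in> {0..<T}" "x \<in> D"
  shows "dt T (dx q) t x = dx (dt T q) t x"
  using dt_dx_commute[OF _ open_D assms] Ck_q by (simp add: eval_nat_numeral)

text \<open>Each term is regrouped as two square-dominated factors times, where present, the bounded
  factor \<open>1 / height\<close>.\<close>

lemma dominated_energy: "dominated T D (energy_density \<epsilon> \<mu> \<zeta> q)"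
proof -
  have "dominated T D (\<lambda>t x. (1/2 * (\<zeta> t x * \<zeta> t x) + 1/2 * ((q t x * q t x) * (1 / height \<epsilon> \<zeta> t x)))
      + \<mu> / 6 * ((dx q t x * dx q t x) * (1 / height \<epsilon> \<zeta> t x)))"
    using dominated_add[OF dominated_add[OF dominated_cmult[OF dominated_mult[OF sq_\<zeta>(1) sq_\<zeta>(1)]]
          dominated_cmult[OF dominated_mult_bdd[OF dominated_mult[OF sq_q(1) sq_q(1)] bdd_h]]]
        dominated_cmult[OF dominated_mult_bdd[OF dominated_mult[OF sq_q(3) sq_q(3)] bdd_h]]] .
  also have "(\<lambda>t x. (1/2 * (\<zeta> t x * \<zeta> t x) + 1/2 * ((q t x * q t x) * (1 / height \<epsilon> \<zeta> t x)))
      + \<mu> / 6 * ((dx q t x * dx q t x) * (1 / height \<epsilon> \<zeta> t x))) = energy_density \<epsilon> \<mu> \<zeta> q"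
    by (intro ext) (simp add: energy_density_def power2_eq_square)
  finally show ?thesis .
qed

text \<open>In the cubic terms one factor \<open>q\<close> or \<open>dx q\<close> joins the bounded
  side, together with the square of \<open>1 / height\<close>; the other two form the
  square-dominated pair.\<close>

lemma dominated_energy_dt: "dominated T D energy_dt"
proof -
  let ?k = "\<lambda>t x. 1 / height \<epsilon> \<zeta> t x"
  note kk = loc_bdd_mult[OF bdd_h bdd_h]
  have "dominated T D (\<lambda>t x. \<zeta> t x * dt T \<zeta> t x + (q t x * dt T q t x) * ?k t x
      - \<epsilon> / 2 * ((q t x * dt T \<zeta> t x) * (q t x * (?k t x * ?k t x)))
      + \<mu> / 3 * ((dx q t x * dt T (dx q) t x) * ?k t x)
      - \<mu> * \<epsilon> / 6 * ((dt T \<zeta> t x * dx q t x) * (dx q t x * (?k t x * ?k t x))))"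
    using dominated_diff[OF dominated_add[OF dominated_diff[OF dominated_add[OF
            dominated_mult[OF sq_\<zeta>] dominated_mult_bdd[OF dominated_mult[OF sq_q(1,2)] bdd_h]]
            dominated_cmult[OF dominated_mult_bdd[OF dominated_mult[OF sq_q(1) sq_\<zeta>(2)] loc_bdd_mult[OF bdd(2) kk]]]]
            dominated_cmult[OF dominated_mult_bdd[OF dominated_mult[OF sq_q(3,4)] bdd_h]]]
            dominated_cmult[OF dominated_mult_bdd[OF dominated_mult[OF sq_\<zeta>(2) sq_q(3)] loc_bdd_mult[OF bdd(3) kk]]]] .
  also have "(\<lambda>t x. \<zeta> t x * dt T \<zeta> t x + (q t x * dt T q t x) * ?k t x
      - \<epsilon> / 2 * ((q t x * dt T \<zeta> t x) * (q t x * (?k t x * ?k t x)))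
      + \<mu> / 3 * ((dx q t x * dt T (dx q) t x) * ?k t x)
      - \<mu> * \<epsilon> / 6 * ((dt T \<zeta> t x * dx q t x) * (dx q t x * (?k t x * ?k t x)))) = energy_dt"
    by (intro ext) (simp add: energy_dt_def power2_eq_square mult_ac)
  finally show ?thesis .
qed

text \<open>Of the slope \<open>dx \<zeta>\<close> only a bound enters: \<open>q\<close> and
  \<open>dt T (dx q)\<close> form the square-dominated pair. The cube of \<open>dx q\<close> is
  split into a square and a bounded factor.\<close>

lemma dominated_remainder: "dominated T D (remainder \<epsilon> T \<zeta> q)"
proof -
  let ?k = "\<lambda>t x. 1 / height \<epsilon> \<zeta> t x"
  note kk = loc_bdd_mult[OF bdd_h bdd_h]
  have "dominated T D (\<lambda>t x. 1 / 6 * ((dx q t x * dx q t x) * (dx q t x * (?k t x * ?k t x)))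
      + 1 / 3 * ((q t x * dt T (dx q) t x) * (dx \<zeta> t x * (?k t x * ?k t x))))"
    using dominated_add[OF
        dominated_cmult[OF dominated_mult_bdd[OF dominated_mult[OF sq_q(3) sq_q(3)] loc_bdd_mult[OF bdd(3) kk]]]
        dominated_cmult[OF dominated_mult_bdd[OF dominated_mult[OF sq_q(1,4)] loc_bdd_mult[OF bdd(1) kk]]]] .
  also have "(\<lambda>t x. 1 / 6 * ((dx q t x * dx q t x) * (dx q t x * (?k t x * ?k t x)))
      + 1 / 3 * ((q t x * dt T (dx q) t x) * (dx \<zeta> t x * (?k t x * ?k t x)))) = remainder \<epsilon> T \<zeta> q"
    by (intro ext) (simp add: remainder_def power2_eq_square power3_eq_cube mult_ac)
  finally show ?thesis .
qed

lemma energy_has_derivative: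
  assumes t: "t \<in> {0..<T}" and x: "x \<in> D"
  shows "((\<lambda>s. energy_density \<epsilon> \<mu> \<zeta> q s x) has_real_derivative energy_dt t x) (at t within {0..<T})"
proof -
  have h: "height \<epsilon> \<zeta> t x \<noteq> 0" using pos[OF t x] by simp
  have 1: "((\<lambda>s. \<zeta> s x) has_real_derivative dt T \<zeta> t x) (at t within {0..<T})"
    using has_derivative_dt[of 0, OF _ t x] Ck_\<zeta> by simp
  have 2: "((\<lambda>s. q s x) has_real_derivative dt T q t x) (at t within {0..<T})"
    using has_derivative_dt[of 2, OF _ t x] Ck_q by (simp add: eval_nat_numeral)
  have 3: "((\<lambda>s. dx q s x) has_real_derivative dt T (dx q) t x) (at t within {0..<T})"
    using has_derivative_dt[of 1, OF _ t x] Ck_dxq by (simp add: eval_nat_numeral)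
  have 4: "((\<lambda>s. height \<epsilon> \<zeta> s x) has_real_derivative \<epsilon> * dt T \<zeta> t x) (at t within {0..<T})"
    unfolding height_def by (auto intro!: derivative_eq_intros 1)
  show ?thesis
    unfolding energy_density_def
    by (rule derivative_eq_intros 1 2 3 4 refl | simp add: h)+
       (use h in \<open>simp add: energy_dt_def field_simps power2_eq_square\<close>)
qed

text \<open>Multiply the momentum equation by \<open>q / h\<close> and replace
  \<open>\<partial>\<^sub>t \<zeta>\<close> by \<open>- \<partial>\<^sub>x q\<close>. The transport
  terms combine into the derivative of \<open>\<epsilon> q\<^sup>3 / (2 h\<^sup>2)\<close>. The
  dispersive terms combine into that of
  \<open>\<mu> q \<partial>\<^sub>x \<partial>\<^sub>t q / (3 h)\<close>, except for the derivative
  of \<open>1 / h\<close>, which yields the second term of \<open>remainder\<close>. The cubic term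
  stems from the time derivative of \<open>1 / h\<close> in the energy.\<close>

lemma flux_has_derivative:
  assumes t: "t \<in> {0..<T}" and x: "x \<in> D"
    and p: "(p has_real_derivative dx P t x) (at x)" and pq: "dx q t x * p x = 0"
  shows "(energy_flux \<epsilon> \<mu> T \<zeta> q p t has_real_derivative \<epsilon> * \<mu> * remainder \<epsilon> T \<zeta> q t x - energy_dt t x) (at x)"
proof -
  have h: "height \<epsilon> \<zeta> t x \<noteq> 0" using pos[OF t x] by simp
  have 1: "(\<zeta> t has_real_derivative dx \<zeta> t x) (at x)"
    using has_derivative_dx[of 0, OF _ t x] Ck_\<zeta> by simp
  have 2: "(q t has_real_derivative dx q t x) (at x)"
    using has_derivative_dx[of 2, OF _ t x] Ck_q by (simp add: eval_nat_numeral)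
  have 3: "(dx (dt T q) t has_real_derivative dx (dx (dt T q)) t x) (at x)"
    using has_derivative_dx[of 0, OF _ t x] Ck_dxdtq by simp
  have 4: "(height \<epsilon> \<zeta> t has_real_derivative \<epsilon> * dx \<zeta> t x) (at x)"
    unfolding height_def by (auto intro!: derivative_eq_intros 1)
  have "((\<lambda>x. (q t x)\<^sup>2 / height \<epsilon> \<zeta> t x) has_real_derivative
      (2 * q t x * dx q t x * height \<epsilon> \<zeta> t x - (q t x)\<^sup>2 * (\<epsilon> * dx \<zeta> t x)) / (height \<epsilon> \<zeta> t x)\<^sup>2) (at x)"
    by (rule derivative_eq_intros 2 4 refl | simp add: h)+ (simp add: power2_eq_square)
  then have "dx (\<lambda>t x. (q t x)\<^sup>2 / height \<epsilon> \<zeta> t x) t x =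
      (2 * q t x * dx q t x * height \<epsilon> \<zeta> t x - (q t x)\<^sup>2 * (\<epsilon> * dx \<zeta> t x)) / (height \<epsilon> \<zeta> t x)\<^sup>2"
    unfolding dx_def by (rule DERIV_imp_deriv)
  \<comment> \<open>The momentum equation is solved for \<open>dt T q t x\<close>, so that it can be
    substituted by rewriting.\<close>
  then have mom: "dt T q t x = \<mu> / 3 * dx (dx (dt T q)) t x
      - \<epsilon> * ((2 * q t x * dx q t x * height \<epsilon> \<zeta> t x - (q t x)\<^sup>2 * (\<epsilon> * dx \<zeta> t x)) / (height \<epsilon> \<zeta> t x)\<^sup>2)
      - height \<epsilon> \<zeta> t x * dx \<zeta> t x - height \<epsilon> \<zeta> t x / \<epsilon> * dx P t x"
    using momentum[OF t x] by simp
  have \<zeta>t: "dt T \<zeta> t x = - dx q t x" using mass[OF t x] by simp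
  let ?h = "height \<epsilon> \<zeta> t x"
  have 5: "((\<lambda>x. \<epsilon> * (q t x)\<^sup>2 / (2 * (height \<epsilon> \<zeta> t x)\<^sup>2)) has_real_derivative
      \<epsilon> * (q t x * dx q t x / ?h\<^sup>2 - (q t x)\<^sup>2 * \<epsilon> * dx \<zeta> t x / ?h ^ 3)) (at x)"
    by (rule derivative_eq_intros 2 4 refl | simp add: h)+
       (use h in \<open>simp add: field_simps power2_eq_square power3_eq_cube power4_eq_xxxx\<close>)
  have 6: "((\<lambda>x. \<mu> * dx (dt T q) t x / (3 * height \<epsilon> \<zeta> t x)) has_real_derivative
      \<mu> * (dx (dx (dt T q)) t x / (3 * ?h) - dx (dt T q) t x * \<epsilon> * dx \<zeta> t x / (3 * ?h\<^sup>2))) (at x)"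
    by (rule derivative_eq_intros 3 4 refl | simp add: h)+
       (use h in \<open>simp add: field_simps power2_eq_square\<close>)
  let ?B = "\<epsilon> * (q t x * dx q t x / ?h\<^sup>2 - (q t x)\<^sup>2 * \<epsilon> * dx \<zeta> t x / ?h ^ 3)
      - \<mu> * (dx (dx (dt T q)) t x / (3 * ?h) - dx (dt T q) t x * \<epsilon> * dx \<zeta> t x / (3 * ?h\<^sup>2))"
  have "(energy_flux \<epsilon> \<mu> T \<zeta> q p t has_real_derivative
      dx q t x * (\<zeta> t x + p x / \<epsilon> + Bern_E \<epsilon> \<mu> T \<zeta> q t x)
      + (dx \<zeta> t x + dx P t x / \<epsilon> + ?B) * q t x) (at x)"
    unfolding energy_flux_def Bern_E_def
    by (intro DERIV_mult DERIV_add DERIV_diff 1 2 5 6 DERIV_cdivide p)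
  \<comment> \<open>After substituting \<open>mom\<close>, the mass equation and the equality of
    mixed derivatives, this is an identity of rational expressions with nonzero \<open>?h\<close>
    and \<open>\<epsilon>\<close>. The only excess from the product rule is
    \<open>dx q t x * p x / \<epsilon>\<close>.\<close>
  also have "dx q t x * (\<zeta> t x + p x / \<epsilon> + Bern_E \<epsilon> \<mu> T \<zeta> q t x)
      + (dx \<zeta> t x + dx P t x / \<epsilon> + ?B) * q t x
      = \<epsilon> * \<mu> * remainder \<epsilon> T \<zeta> q t x - energy_dt t x + dx q t x * p x / \<epsilon>"
    using h eps unfolding Bern_E_def remainder_def energy_dt_def mom \<zeta>t dtdx_q[OF t x]
    by (simp add: field_simps power2_eq_square power3_eq_cube power4_eq_xxxx)
  finally show ?thesis using pq by simp
qed

text \<open>Integrating \<open>flux_has_derivative\<close> in \<open>x\<close> turns the flux into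
  its limits at the ends, while \<open>has_real_derivative_integral\<close> moves the time
  derivative outside the integral. The potential \<open>p\<close> is a function of \<open>x\<close>
  alone, since the flux is evaluated only at the time \<open>t\<close>.\<close>

lemma energy_balance:
  assumes t: "t \<in> {0..<T}"
    and p: "\<And>x. x \<in> D \<Longrightarrow> (p has_real_derivative dx P t x) (at x)"
    and pq: "\<And>x. x \<in> D \<Longrightarrow> dx q t x * p x = 0"
    and A: "((energy_flux \<epsilon> \<mu> T \<zeta> q p t \<circ> real_of_ereal) \<longlongrightarrow> A) (at_right a)"
    and B: "((energy_flux \<epsilon> \<mu> T \<zeta> q p t \<circ> real_of_ereal) \<longlongrightarrow> B) (at_left b)"
  shows "((\<lambda>s. LINT x:D|lborel. energy_density \<epsilon> \<mu> \<zeta> q s x) has_real_derivative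
      \<epsilon> * \<mu> * (LINT x:D|lborel. remainder \<epsilon> T \<zeta> q t x) + A - B) (at t within {0..<T})"
proof -
  let ?f = "\<lambda>t x. \<epsilon> * \<mu> * remainder \<epsilon> T \<zeta> q t x - energy_dt t x"
  have int_f: "dominated T D ?f"
    by (intro dominated_diff dominated_cmult dominated_remainder dominated_energy_dt)
  note int = dominated_integrable[OF _ t open_D]
  have "(LBINT x=a..b. ?f t x) = B - A"
  proof (rule interval_integral_FTC_integrable[OF ab _ _ _ A B])
    fix x assume "a < ereal x" "ereal x < b"
    then have x: "x \<in> D" by (simp add: D_def einterval_iff)
    show "(energy_flux \<epsilon> \<mu> T \<zeta> q p t has_vector_derivative ?f t x) (at x)"
      unfolding has_real_derivative_iff_has_vector_derivative[symmetric]
      by (rule flux_has_derivative[OF t x p[OF x] pq[OF x]])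
    have "continuous_on D (?f t)" using int_f t unfolding dominated_def by blast
    then show "isCont (?f t) x"
      using open_D x by (simp add: continuous_on_eq_continuous_at)
  next
    show "set_integrable lborel (einterval a b) (?f t)"
      using int[OF int_f] by (simp add: D_def)
  qed
  then have "(LINT x:D|lborel. ?f t x) = B - A"
    using ab by (simp add: interval_lebesgue_integral_le_eq D_def)
  moreover have "(LINT x:D|lborel. ?f t x) = (LINT x:D|lborel. \<epsilon> * \<mu> * remainder \<epsilon> T \<zeta> q t x)
      - (LINT x:D|lborel. energy_dt t x)"
    by (rule set_integral_diff(2)[OF int[OF dominated_cmult[OF dominated_remainder]] int[OF dominated_energy_dt]])
  ultimately have "(LINT x:D|lborel. energy_dt t x)
      = \<epsilon> * \<mu> * (LINT x:D|lborel. remainder \<epsilon> T \<zeta> q t x) + A - B"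
    by simp
  then show ?thesis
    using has_real_derivative_integral[OF open_D t dominated_energy dominated_energy_dt energy_has_derivative]
    by simp
qed

text \<open>Here \<open>\<zeta>\<close> itself has to be integrable, which square-integrable decay
  on the half line does not give; hence the separate assumptions. By the mass equation
  \<open>- q t\<close> is an antiderivative of \<open>dt T \<zeta> t\<close>.\<close>

lemma mass_balance:
  assumes t: "t \<in> {0..<T}"
    and int: "dominated T D \<zeta>" "dominated T D (dt T \<zeta>)"
    and A: "((q t \<circ> real_of_ereal) \<longlongrightarrow> A) (at_right a)"
    and B: "((q t \<circ> real_of_ereal) \<longlongrightarrow> B) (at_left b)"
  shows "((\<lambda>s. LINT x:D|lborel. \<zeta> s x) has_real_derivative A - B) (at t within {0..<T})"
proof -
  have "(LBINT x=a..b. dt T \<zeta> t x) = - B - - A"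
  proof (rule interval_integral_FTC_integrable[OF ab])
    fix x assume "a < ereal x" "ereal x < b"
    then have x: "x \<in> D" by (simp add: D_def einterval_iff)
    have "(q t has_real_derivative dx q t x) (at x)"
      using has_derivative_dx[of 2, OF _ t x] Ck_q by (simp add: eval_nat_numeral)
    then have "((\<lambda>x. - q t x) has_real_derivative - dx q t x) (at x)"
      by (rule DERIV_minus)
    then show "((\<lambda>x. - q t x) has_vector_derivative dt T \<zeta> t x) (at x)"
      unfolding has_real_derivative_iff_has_vector_derivative[symmetric]
      using mass[OF t x] by (simp add: eq_neg_iff_add_eq_0[symmetric])
    have "continuous_on D (dt T \<zeta> t)" using int(2) t unfolding dominated_def by blast
    then show "isCont (dt T \<zeta> t) x"
      using open_D x by (simp add: continuous_on_eq_continuous_at)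
  next
    show "set_integrable lborel (einterval a b) (dt T \<zeta> t)"
      using dominated_integrable[OF int(2) t open_D] by (simp add: D_def)
    show "(((\<lambda>x. - q t x) \<circ> real_of_ereal) \<longlongrightarrow> - A) (at_right a)"
      using tendsto_minus[OF A] by (simp add: comp_def)
    show "(((\<lambda>x. - q t x) \<circ> real_of_ereal) \<longlongrightarrow> - B) (at_left b)"
      using tendsto_minus[OF B] by (simp add: comp_def)
  qed
  then have "(LINT x:D|lborel. dt T \<zeta> t x) = A - B"
    using ab by (simp add: interval_lebesgue_integral_le_eq D_def)
  moreover have "((\<lambda>s. LINT x:D|lborel. \<zeta> s x) has_real_derivative (LINT x:D|lborel. dt T \<zeta> t x))
      (at t within {0..<T})"
    by (rule has_real_derivative_integral[OF open_D t int])
       (use has_derivative_dt[of 0] Ck_\<zeta> in simp)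
  ultimately show ?thesis by simp
qed

end

section \<open>Decay, traces at interior points, fields constant in space\<close>

lemma decaying_dt: "decaying (Suc k) T D u \<Longrightarrow> decaying k T D (dt T u)"
  and decaying_dx: "decaying (Suc k) T D u \<Longrightarrow> decaying k T D (dx u)"
  by (simp_all only: decaying.simps(2))

lemma decaying_0:
  assumes "decaying k T D u"
  shows "decaying 0 T D u"
  using assms by (cases k) (simp_all only: decaying.simps(2))

lemma decaying_tendsto_0:
  assumes "decaying 0 T {..<c} u" "t \<in> {0..<T}"
  shows "(u t \<longlongrightarrow> 0) at_bot"
proof -
  obtain g where g: "(g \<longlongrightarrow> 0) at_bot" "\<And>s x. s \<in> {0..t} \<Longrightarrow> x \<in> {..<c} \<Longrightarrow> \<bar>u s x\<bar> \<le> g x"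
    using decaying_bound[OF assms] by metis
  have "eventually (\<lambda>x. norm (u t x) \<le> g x) at_bot"
    using eventually_gt_at_bot[of c] by eventually_elim (use g(2)[of t] assms(2) in auto)
  then show ?thesis by (rule Lim_null_comparison[OF _ g(1)])
qed

lemma bdry_trace_interior:
  assumes "Ck_closure 0 T D u" "open D" "t \<in> {0..<T}" "x \<in> D"
  shows "bdry_trace D (u t) x = u t x"
proof -
  obtain v where v: "continuous_on ({0..<T} \<times> closure D) (\<lambda>(t, x). v t x)"
    and eq: "\<And>t x. t \<in> {0..<T} \<Longrightarrow> x \<in> D \<Longrightarrow> u t x = v t x"
    using assms(1) unfolding Ck_closure.simps(1) by blast
  show ?thesis
    using bdry_trace_eq_extension(2)[OF v eq assms(2,3)] eq[OF assms(3,4)] assms(4) closure_subset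
    by fastforce
qed

lemma dx_eq_0:
  assumes "open D" "x \<in> D" "\<And>y. y \<in> D \<Longrightarrow> u t y = c"
  shows "dx u t x = 0"
proof -
  have "(u t has_field_derivative 0) (at x)"
    by (rule has_field_derivative_transform_within_open[OF DERIV_const[of c] assms(1,2)])
       (use assms(3) in simp)
  then show ?thesis unfolding dx_def by (rule DERIV_imp_deriv)
qed

subsection \<open>The three domains\<close>

lemma solution_on_domain:
  assumes D: "D \<in> {Ext_minus r, Int_dom r, Ext_plus r l}"
    and reg: "regular r l T \<zeta> q P"
    and sol: "constrained_sw_solution \<epsilon> \<mu> r l P0 \<kappa> \<zeta>w T \<zeta> q P"
  shows "open D" "Ck_closure 1 T D \<zeta>" "Ck_closure 3 T D q" "Ck_closure 1 T D P"
    and "\<And>t x. t \<in> {0..<T} \<Longrightarrow> x \<in> closure D \<Longrightarrow> 1 + \<epsilon> * bdry_trace D (\<zeta> t) x > 0"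
    and "\<And>t x. t \<in> {0..<T} \<Longrightarrow> x \<in> D \<Longrightarrow> height \<epsilon> \<zeta> t x > 0"
    and "\<And>t x. t \<in> {0..<T} \<Longrightarrow> x \<in> D \<Longrightarrow> dt T \<zeta> t x + dx q t x = 0"
    and "\<And>t x. t \<in> {0..<T} \<Longrightarrow> x \<in> D \<Longrightarrow>
        (dt T q t x - \<mu> / 3 * dx (dx (dt T q)) t x)
          + \<epsilon> * dx (\<lambda>t x. (q t x)\<^sup>2 / height \<epsilon> \<zeta> t x) t x
          + height \<epsilon> \<zeta> t x * dx \<zeta> t x
        = - (height \<epsilon> \<zeta> t x / \<epsilon>) * dx P t x"
proof -
  show D': "open D" using D by (auto simp: Ext_minus_def Int_dom_def Ext_plus_def)
  show C\<zeta>: "Ck_closure 1 T D \<zeta>" and "Ck_closure 3 T D q" and "Ck_closure 1 T D P"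
    using reg D unfolding regular_def by blast+
  show pos: "1 + \<epsilon> * bdry_trace D (\<zeta> t) x > 0" if "t \<in> {0..<T}" "x \<in> closure D" for t x
    using sol D that unfolding constrained_sw_solution_def by blast
  show "height \<epsilon> \<zeta> t x > 0" if "t \<in> {0..<T}" "x \<in> D" for t x
    using pos[OF that(1), of x] closure_subset[of D] that
      bdry_trace_interior[OF Ck_closure_0[OF C\<zeta>] D' that]
    unfolding height_def by auto
  show "dt T \<zeta> t x + dx q t x = 0" if "t \<in> {0..<T}" "x \<in> D" for t x
    using sol D that unfolding constrained_sw_solution_def by blast
  show "(dt T q t x - \<mu> / 3 * dx (dx (dt T q)) t x)
          + \<epsilon> * dx (\<lambda>t x. (q t x)\<^sup>2 / height \<epsilon> \<zeta> t x) t x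
          + height \<epsilon> \<zeta> t x * dx \<zeta> t x
        = - (height \<epsilon> \<zeta> t x / \<epsilon>) * dx P t x" if "t \<in> {0..<T}" "x \<in> D" for t x
    using sol D that unfolding constrained_sw_solution_def by blast
qed

lemma sw_domain_bounded:
  assumes eps: "0 < \<epsilon>" and ab: "a < b"
    and D: "{a<..<b} \<in> {Ext_minus r, Int_dom r, Ext_plus r l}"
    and reg: "regular r l T \<zeta> q P"
    and sol: "constrained_sw_solution \<epsilon> \<mu> r l P0 \<kappa> \<zeta>w T \<zeta> q P"
  shows "sw_domain \<epsilon> \<mu> T (ereal a) (ereal b) \<zeta> q P {a<..<b}"
proof -
  note s = solution_on_domain[OF D reg sol]
  have C: "Ck_closure 0 T {a<..<b} \<zeta>" "Ck_closure 0 T {a<..<b} (dt T \<zeta>)"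
    "Ck_closure 0 T {a<..<b} (dx \<zeta>)" "Ck_closure 0 T {a<..<b} q" "Ck_closure 0 T {a<..<b} (dt T q)"
    "Ck_closure 0 T {a<..<b} (dx q)" "Ck_closure 0 T {a<..<b} (dt T (dx q))"
    using s(2,3) unfolding eval_nat_numeral One_nat_def
    by (blast intro: Ck_closure_0 Ck_closure_dt Ck_closure_dx)+
  have bdd: "loc_bdd T {a<..<b} u" if "Ck_closure 0 T {a<..<b} u" for u
    by (rule loc_bdd_bounded[OF that]) simp
  have sq: "sq_dominated T {a<..<b} u" if "Ck_closure 0 T {a<..<b} u" for u
    by (rule sq_dominated_bounded[OF bdd[OF that]]) simp_all
  have bdd_h: "loc_bdd T {a<..<b} (\<lambda>t x. 1 / height \<epsilon> \<zeta> t x)"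
  proof (rule inverse_height_bounded[OF C(1) s(1) s(5)])
    \<comment> \<open>The whole closed interval is taken as \<open>S\<close>, so the smallness
      condition is empty.\<close>
    show "\<exists>S. compact S \<and> (\<forall>t\<in>{0..t1}. \<forall>x\<in>{a<..<b} - S. \<bar>\<epsilon> * \<zeta> t x\<bar> \<le> 1 / 2)" for t1
      by (intro exI[of _ "{a..b}"]) auto
  qed
  show ?thesis
    by unfold_locales
      (rule s(2,3) C[THEN sq] C[THEN bdd] bdd_h eps | (rule s(6,7,8); assumption) | simp add: ab)+
qed

lemma sw_domain_left:
  assumes eps: "0 < \<epsilon>"
    and reg: "regular r l T \<zeta> q P"
    and sol: "constrained_sw_solution \<epsilon> \<mu> r l P0 \<kappa> \<zeta>w T \<zeta> q P"
  shows "sw_domain \<epsilon> \<mu> T (-\<infinity>) (ereal (- r)) \<zeta> q P {..< - r}"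
proof -
  have D: "{..< - r} \<in> {Ext_minus r, Int_dom r, Ext_plus r l}" by (simp add: Ext_minus_def)
  note s = solution_on_domain[OF D reg sol]
  have C: "Ck_closure 0 T {..< - r} \<zeta>" "Ck_closure 0 T {..< - r} (dt T \<zeta>)"
    "Ck_closure 0 T {..< - r} (dx \<zeta>)" "Ck_closure 0 T {..< - r} q" "Ck_closure 0 T {..< - r} (dt T q)"
    "Ck_closure 0 T {..< - r} (dx q)" "Ck_closure 0 T {..< - r} (dt T (dx q))"
    using s(2,3) unfolding eval_nat_numeral One_nat_def
    by (blast intro: Ck_closure_0 Ck_closure_dt Ck_closure_dx)+
  have "decaying 1 T {..< - r} \<zeta>" "decaying 3 T {..< - r} q"
    using reg unfolding regular_def Ext_minus_def by blast+
  then have dec: "decaying 0 T {..< - r} \<zeta>" "decaying 0 T {..< - r} (dt T \<zeta>)"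
    "decaying 0 T {..< - r} (dx \<zeta>)" "decaying 0 T {..< - r} q" "decaying 0 T {..< - r} (dt T q)"
    "decaying 0 T {..< - r} (dx q)" "decaying 0 T {..< - r} (dt T (dx q))"
    unfolding eval_nat_numeral One_nat_def
    by (blast intro: decaying_0 decaying_dt decaying_dx)+
  have bdd_h: "loc_bdd T {..< - r} (\<lambda>t x. 1 / height \<epsilon> \<zeta> t x)"
  proof (rule inverse_height_bounded[OF C(1) s(1) s(5)])
    fix t1 assume "t1 \<in> {0..<T}"
    \<comment> \<open>With this threshold, decay gives
      \<open>\<bar>\<epsilon> * \<zeta> t x\<bar> \<le> 1 / 2\<close> to the left of
      \<open>M\<close>, which keeps the height away from \<open>0\<close> there.\<close>
    moreover have "1 / (2 * \<epsilon>) > 0" using eps by simp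
    ultimately obtain M where
      M: "\<And>t x. t \<in> {0..t1} \<Longrightarrow> x \<in> {..< - r} - {M..- r} \<Longrightarrow> \<bar>\<zeta> t x\<bar> \<le> 1 / (2 * \<epsilon>)"
      using decaying_small[OF dec(1)] by metis
    have "\<bar>\<epsilon> * \<zeta> t x\<bar> \<le> 1 / 2" if "t \<in> {0..t1}" "x \<in> {..< - r} - {M..- r}" for t x
      using M[OF that] eps by (simp add: abs_mult field_simps)
    then show "\<exists>S. compact S \<and> (\<forall>t\<in>{0..t1}. \<forall>x\<in>{..< - r} - S. \<bar>\<epsilon> * \<zeta> t x\<bar> \<le> 1 / 2)"
      by (intro exI[of _ "{M..- r}"]) auto
  qed
  show ?thesis
    by unfold_locales
      (rule s(2,3) bdd_h eps | (rule s(6,7,8); assumption)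
        | (rule sq_dominated_decaying loc_bdd_decaying; rule C dec) | simp)+
qed

section \<open>Energy flux at the ends of a domain\<close>

text \<open>The height has a positive trace, so \<open>Bern_E\<close> depends continuously on traces
  that exist. The limit is stated with the trace of \<open>Bern_E\<close> itself, the quantity
  occurring in the Bernoulli principles.\<close>

lemma energy_flux_tendsto_bdry:
  assumes D: "open D" and t: "t \<in> {0..<T}" and c: "c \<in> closure D"
    and C: "Ck_closure 0 T D \<zeta>" "Ck_closure 0 T D q" "Ck_closure 0 T D (dx (dt T q))"
    and pos: "1 + \<epsilon> * bdry_trace D (\<zeta> t) c > 0"
    and p: "(p \<longlongrightarrow> p0) (at c within D)"
  shows "(energy_flux \<epsilon> \<mu> T \<zeta> q p t \<longlongrightarrow> bdry_trace D (q t) c *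
      (bdry_trace D (\<zeta> t) c + p0 / \<epsilon> + bdry_trace D (Bern_E \<epsilon> \<mu> T \<zeta> q t) c)) (at c within D)"
proof -
  note lim = bdry_trace_tendsto[OF _ D t c]
  define B where "B = \<epsilon> * (bdry_trace D (q t) c)\<^sup>2 / (2 * (1 + \<epsilon> * bdry_trace D (\<zeta> t) c)\<^sup>2)
      - \<mu> * bdry_trace D (dx (dt T q) t) c / (3 * (1 + \<epsilon> * bdry_trace D (\<zeta> t) c))"
  have B: "(Bern_E \<epsilon> \<mu> T \<zeta> q t \<longlongrightarrow> B) (at c within D)"
    unfolding Bern_E_def height_def B_def using pos
    by (intro tendsto_intros lim C) auto
  then have eq: "bdry_trace D (Bern_E \<epsilon> \<mu> T \<zeta> q t) c = B"
    unfolding bdry_trace_def by (rule tendsto_Lim[OF open_not_trivial_limit_closure[OF D c]])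
  show ?thesis
    unfolding eq energy_flux_def divide_inverse
    by (intro tendsto_mult tendsto_add tendsto_const B p lim C)
qed

lemma energy_flux_tendsto_at_bot:
  assumes "(\<zeta> t \<longlongrightarrow> 0) at_bot" "(q t \<longlongrightarrow> 0) at_bot" "(dx (dt T q) t \<longlongrightarrow> 0) at_bot"
  shows "(energy_flux \<epsilon> \<mu> T \<zeta> q (\<lambda>_. 0) t \<longlongrightarrow> 0) at_bot"
proof -
  \<comment> \<open>The height tends to \<open>1\<close>, and the factor \<open>q\<close> sends the
    product to \<open>0\<close>. The zeros stay unsimplified so that the limit rules match term by
    term.\<close>
  have "((\<lambda>x. q t x * (\<zeta> t x + 0 / \<epsilon> + (\<epsilon> * (q t x)\<^sup>2 / (2 * (1 + \<epsilon> * \<zeta> t x)\<^sup>2)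
        - \<mu> * dx (dt T q) t x / (3 * (1 + \<epsilon> * \<zeta> t x)))))
      \<longlongrightarrow> 0 * (0 + 0 / \<epsilon> + (\<epsilon> * 0\<^sup>2 / (2 * (1 + \<epsilon> * 0)\<^sup>2) - \<mu> * 0 / (3 * (1 + \<epsilon> * 0))))) at_bot"
    by (intro tendsto_mult tendsto_add tendsto_diff tendsto_divide tendsto_power tendsto_const assms) auto
  moreover have "energy_flux \<epsilon> \<mu> T \<zeta> q (\<lambda>_. 0) t = (\<lambda>x. q t x * (\<zeta> t x + 0 / \<epsilon>
      + (\<epsilon> * (q t x)\<^sup>2 / (2 * (1 + \<epsilon> * \<zeta> t x)\<^sup>2) - \<mu> * dx (dt T q) t x / (3 * (1 + \<epsilon> * \<zeta> t x)))))"
    by (simp add: fun_eq_iff energy_flux_def Bern_E_def height_def)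
  ultimately show ?thesis by simp
qed

section \<open>Additivity of the integral across the contact points\<close>

text \<open>The integral in \<open>E_tot\<close> runs over \<open>{..<l}\<close>, which contains the
  contact points, while the three open domains omit them. A point is a null set, whatever value the
  fields take there.\<close>

lemma set_integral_insert:
  fixes f :: "real \<Rightarrow> real"
  assumes A: "c \<notin> A" and f: "set_integrable lborel A f"
  shows "set_integrable lborel (insert c A) f"
    and "(LINT x:insert c A|lborel. f x) = (LINT x:A|lborel. f x)"
proof -
  have eq: "(\<lambda>x. indicator {c} x *\<^sub>R f x) = (\<lambda>x. indicator {c} x *\<^sub>R f c)"
    by (auto split: split_indicator)
  have c: "set_integrable lborel {c} f"
    unfolding set_integrable_def eq
    by (intro integrable_scaleR_left integrable_real_indicator) auto
  have 0: "(LINT x:{c}|lborel. f x) = 0"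
    unfolding set_lebesgue_integral_def eq by simp
  have "(\<lambda>x. indicator (insert c A) x *\<^sub>R f x)
      = (\<lambda>x. indicator {c} x *\<^sub>R f x + indicator A x *\<^sub>R f x)"
    using A by (auto simp: fun_eq_iff split: split_indicator)
  then show "set_integrable lborel (insert c A) f"
    using c f unfolding set_integrable_def by simp
  have "(LINT x:{c} \<union> A|lborel. f x) = (LINT x:{c}|lborel. f x) + (LINT x:A|lborel. f x)"
    by (rule set_integral_Un[OF _ c f]) (use A in auto)
  then show "(LINT x:insert c A|lborel. f x) = (LINT x:A|lborel. f x)"
    using 0 by simp
qed

lemma set_integral_split:
  fixes f :: "real \<Rightarrow> real"
  assumes "a < b" "b < l"
    and f: "set_integrable lborel {..<a} f" "set_integrable lborel {a<..<b} f" "set_integrable lborel {b<..<l} f"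
  shows "(LINT x:{..<l}|lborel. f x)
    = (LINT x:{..<a}|lborel. f x) + (LINT x:{a<..<b}|lborel. f x) + (LINT x:{b<..<l}|lborel. f x)"
proof -
  have 1: "set_integrable lborel ({..<a} \<union> insert a {a<..<b}) f"
    by (intro set_integrable_Un f(1) set_integral_insert(1) f(2)) auto
  have "{..<l} = ({..<a} \<union> insert a {a<..<b}) \<union> insert b {b<..<l}"
    using assms(1,2) by auto
  then have "(LINT x:{..<l}|lborel. f x) = (LINT x:({..<a} \<union> insert a {a<..<b}) \<union> insert b {b<..<l}|lborel. f x)"
    by simp
  also have "\<dots> = (LINT x:{..<a} \<union> insert a {a<..<b}|lborel. f x) + (LINT x:insert b {b<..<l}|lborel. f x)"
    by (rule set_integral_Un[OF _ 1 set_integral_insert(1)[OF _ f(3)]]) (use assms(1) in auto)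
  also have "(LINT x:{..<a} \<union> insert a {a<..<b}|lborel. f x)
      = (LINT x:{..<a}|lborel. f x) + (LINT x:insert a {a<..<b}|lborel. f x)"
    by (rule set_integral_Un[OF _ f(1) set_integral_insert(1)[OF _ f(2)]]) auto
  finally show ?thesis
    using set_integral_insert(2)[OF _ f(2), of a] set_integral_insert(2)[OF _ f(3), of b] by simp
qed

text \<open>As \<open>q\<close> equals \<open>q_int q t\<close> throughout the interior, its mixed
  derivative vanishes and the dispersive term of \<open>Bern_E\<close> drops out. For
  \<open>p = P t\<close> the second factor is the interior side of the Bernoulli principles.\<close>

lemma interior_energy_flux:
  assumes reg: "regular r l T \<zeta> q P"
    and sol: "constrained_sw_solution \<epsilon> \<mu> r l P0 \<kappa> \<zeta>w T \<zeta> q P"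
    and t: "t \<in> {0..<T}" and x: "x \<in> Int_dom r"
  shows "energy_flux \<epsilon> \<mu> T \<zeta> q p t x
    = q_int q t * (\<zeta>w + p x / \<epsilon> + \<epsilon> * ((q_int q t)\<^sup>2 / (2 * (1 + \<epsilon> * \<zeta>w)\<^sup>2)))"
    and "dx q t x = 0"
proof -
  note q = interior_discharge[OF reg sol]
  have op: "open (Int_dom r)" by (simp add: Int_dom_def)
  \<comment> \<open>For every \<open>y\<close> the function of time is the same on
    \<open>{0..<T}\<close>, so its one-sided derivative does not depend on \<open>y\<close>.\<close>
  have "dt T q t y = vector_derivative (q_int q) (at t within {0..<T})" if "y \<in> Int_dom r" for y
    unfolding dt_def using q[OF _ that] t
    by (intro vector_derivative_cong_eq) (auto intro: always_eventually)
  then have "dx (dt T q) t x = 0" by (rule dx_eq_0[OF op x])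
  moreover have "\<zeta> t x = \<zeta>w"
    using sol t x unfolding constrained_sw_solution_def by blast
  ultimately show "energy_flux \<epsilon> \<mu> T \<zeta> q p t x
    = q_int q t * (\<zeta>w + p x / \<epsilon> + \<epsilon> * ((q_int q t)\<^sup>2 / (2 * (1 + \<epsilon> * \<zeta>w)\<^sup>2)))"
    using q[OF t x] by (simp add: energy_flux_def Bern_E_def height_def)
  show "dx q t x = 0" using q[OF t] by (rule dx_eq_0[OF op x])
qed

section \<open>Balance of the total energy\<close>

theorem proposition4p4:
  fixes \<epsilon> \<mu> r l P0 \<kappa> \<zeta>w T :: real
    and \<zeta> q P :: "real \<Rightarrow> real \<Rightarrow> real"
  assumes eps: "0 < \<epsilon>" "\<epsilon> \<le> 1"
    and mu: "0 \<le> \<mu>"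
    and geom: "0 < r" "r < l"
    and P0: "0 < P0"
    and hw: "1 + \<epsilon> * \<zeta>w > 0"
    and T: "0 < T"
    and kappa: "\<kappa> = 0"
    and regular: "regular r l T \<zeta> q P"
    and solution: "constrained_sw_solution \<epsilon> \<mu> r l P0 \<kappa> \<zeta>w T \<zeta> q P"
    and continuity: "\<And>t x. t \<in> {0..<T} \<Longrightarrow> x \<in> {-r, r} \<Longrightarrow> bdry_trace (Ext r l) (q t) x = q_int q t"
    and bernoulli_minus: "\<And>t. t \<in> {0..<T} \<Longrightarrow>
      \<zeta>w + bdry_trace (Int_dom r) (P t) (- r) / \<epsilon> + \<epsilon> * ((q_int q t)\<^sup>2 / (2 * (1 + \<epsilon> * \<zeta>w)\<^sup>2))
      = bdry_trace (Ext r l) (\<zeta> t) (- r) + bdry_trace (Ext r l) (Bern_E \<epsilon> \<mu> T \<zeta> q t) (- r)"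
    and bernoulli_plus: "\<And>t. t \<in> {0..<T} \<Longrightarrow>
      \<zeta>w + bdry_trace (Int_dom r) (P t) r / \<epsilon> + \<epsilon> * ((q_int q t)\<^sup>2 / (2 * (1 + \<epsilon> * \<zeta>w)\<^sup>2))
      = bdry_trace (Ext r l) (\<zeta> t) r + chamber_term r l P0 \<kappa> \<zeta> t
        + bdry_trace (Ext r l) (Bern_E \<epsilon> \<mu> T \<zeta> q t) r"
  shows "\<forall>t\<in>{0..<T}.
    (E_tot \<epsilon> \<mu> r l P0 \<zeta> q has_real_derivative
       \<epsilon> * \<mu> * (LINT x:{..<l}|lborel. remainder \<epsilon> T \<zeta> q t x)) (at t within {0..<T})"
proof
  fix t assume t: "t \<in> {0..<T}"
  define Dm Di Dp where D_defs: "Dm = {..< - r}" "Di = {- r<..<r}" "Dp = {r<..<l}"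
  have D_eq: "Ext_minus r = Dm" "Int_dom r = Di" "Ext_plus r l = Dp"
    by (simp_all add: D_defs Ext_minus_def Int_dom_def Ext_plus_def)
  note dom = solution_on_domain[OF _ regular solution, unfolded D_eq]
  have mem: "Dm \<in> {Dm, Di, Dp}" "Di \<in> {Dm, Di, Dp}" "Dp \<in> {Dm, Di, Dp}" by auto
  have op: "open Dm" "open Di" "open Dp" by (simp_all add: D_defs)
  interpret m: sw_domain \<epsilon> \<mu> T "- \<infinity>" "ereal (- r)" \<zeta> q P Dm
    unfolding D_defs by (rule sw_domain_left[OF eps(1) regular solution])
  interpret i: sw_domain \<epsilon> \<mu> T "ereal (- r)" "ereal r" \<zeta> q P Di
    unfolding D_defs
    by (rule sw_domain_bounded[OF eps(1) _ _ regular solution]) (use geom in \<open>auto simp: Int_dom_def\<close>)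
  interpret p: sw_domain \<epsilon> \<mu> T "ereal r" "ereal l" \<zeta> q P Dp
    unfolding D_defs
    by (rule sw_domain_bounded[OF eps(1) _ _ regular solution]) (use geom in \<open>auto simp: Ext_plus_def\<close>)

  \<comment> \<open>Traces are limits within a domain, while \<open>energy_balance\<close> asks for
    one-sided limits; the filters agree at each end.\<close>
  have at_D: "at (- r) within Dm = at_left (- r)" "at (- r) within Di = at_right (- r)"
    "at r within Di = at_left r" "at r within Dp = at_right r" "at l within Dp = at_left l"
  proof -
    show "at (- r) within Dm = at_left (- r)"
      by (simp add: D_defs)
    show "at (- r) within Di = at_right (- r)"
      unfolding D_defs by (rule at_within_nhd[where S = "{..<r}"]) (use geom in auto)
    show "at r within Di = at_left r"
      unfolding D_defs by (rule at_within_nhd[where S = "{- r<..}"]) (use geom in auto)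
    show "at r within Dp = at_right r"
      unfolding D_defs by (rule at_within_nhd[where S = "{..<l}"]) (use geom in auto)
    show "at l within Dp = at_left l"
      unfolding D_defs by (rule at_within_nhd[where S = "{r<..}"]) (use geom in auto)
  qed
  \<comment> \<open>Near a contact point the exterior consists of one component only, as the
    interior has positive width.\<close>
  have at_Ext: "at (- r) within Ext r l = at (- r) within Dm" "at r within Ext r l = at r within Dp"
  proof -
    show "at (- r) within Ext r l = at (- r) within Dm"
      unfolding Ext_def D_eq unfolding D_defs
      by (rule at_within_nhd[where S = "{..<r}"]) (use geom in auto)
    show "at r within Ext r l = at r within Dp"
      unfolding Ext_def D_eq unfolding D_defs
      by (rule at_within_nhd[where S = "{- r<..}"]) (use geom in auto)
  qed
  have trace_Ext: "bdry_trace (Ext r l) f (- r) = bdry_trace Dm f (- r)"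
    "bdry_trace (Ext r l) f r = bdry_trace Dp f r" for f
    unfolding bdry_trace_def at_Ext by simp_all
  have cl: "- r \<in> closure Dm" "- r \<in> closure Di" "r \<in> closure Di" "r \<in> closure Dp" "l \<in> closure Dp"
    using geom by (simp_all add: D_defs)

  have C: "Ck_closure 0 T D \<zeta>" "Ck_closure 0 T D q" "Ck_closure 0 T D (dx (dt T q))"
    "Ck_closure 0 T D P" "Ck_closure 1 T D P" if "D \<in> {Dm, Di, Dp}" for D
    using dom(2-4)[OF that] unfolding eval_nat_numeral One_nat_def
    by (blast intro: Ck_closure_0 Ck_closure_dt Ck_closure_dx)+
  define Q M where "Q = q_int q t" and "M = mean_plus r l (\<zeta> t)"
  have qm: "bdry_trace Dm (q t) (- r) = Q" and qp: "bdry_trace Dp (q t) r = Q"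
    using continuity[OF t, of "- r"] continuity[OF t, of r] by (simp_all add: trace_Ext Q_def)
  have ql: "bdry_trace Dp (q t) l = 0"
    using solution t unfolding constrained_sw_solution_def D_eq by blast
  have P_const: "P t x = 0" if "x \<in> Dm" for x
    using solution t that unfolding constrained_sw_solution_def D_eq by blast
  have P_const': "P t x = \<epsilon> * chamber_term r l P0 \<kappa> \<zeta> t" if "x \<in> Dp" for x
    using solution t that unfolding constrained_sw_solution_def D_eq by blast

  let ?e = "energy_density \<epsilon> \<mu> \<zeta> q" and ?R = "remainder \<epsilon> T \<zeta> q"
  \<comment> \<open>The exterior sides of the Bernoulli principles without the chamber pressure,
    because the exterior fluxes are taken with the potential \<open>0\<close>.\<close>
  define Bm Bp where "Bm = bdry_trace Dm (\<zeta> t) (- r) + bdry_trace Dm (Bern_E \<epsilon> \<mu> T \<zeta> q t) (- r)"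
    and "Bp = bdry_trace Dp (\<zeta> t) r + bdry_trace Dp (Bern_E \<epsilon> \<mu> T \<zeta> q t) r"
  \<comment> \<open>No flux comes in from minus infinity, by decay; the flux leaving at
    \<open>- r\<close> is \<open>Q * Bm\<close>.\<close>
  have Em: "((\<lambda>s. LINT x:Dm|lborel. ?e s x) has_real_derivative
      \<epsilon> * \<mu> * (LINT x:Dm|lborel. ?R t x) + 0 - Q * Bm) (at t within {0..<T})"
  proof (rule m.energy_balance[OF t])
    show "((\<lambda>_. 0) has_real_derivative dx P t x) (at x)" if "x \<in> Dm" for x
      using dx_eq_0[where u = P and t = t, OF op(1) that P_const] by simp
    have "decaying 1 T Dm \<zeta>" "decaying 3 T Dm q"
      using regular unfolding regular_def D_eq by blast+
    then have dec: "decaying 0 T Dm \<zeta>" "decaying 0 T Dm q" "decaying 0 T Dm (dx (dt T q))"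
      unfolding eval_nat_numeral One_nat_def by (blast intro: decaying_0 decaying_dt decaying_dx)+
    note bot = decaying_tendsto_0[OF _ t, where c = "- r", folded D_defs(1)]
    show "((energy_flux \<epsilon> \<mu> T \<zeta> q (\<lambda>_. 0) t \<circ> real_of_ereal) \<longlongrightarrow> 0) (at_right (- \<infinity>))"
      unfolding ereal_tendsto_simps
      by (intro energy_flux_tendsto_at_bot bot dec)
    show "((energy_flux \<epsilon> \<mu> T \<zeta> q (\<lambda>_. 0) t \<circ> real_of_ereal) \<longlongrightarrow> Q * Bm) (at_left (ereal (- r)))"
      unfolding ereal_tendsto_simps at_D[symmetric]
      using energy_flux_tendsto_bdry[OF op(1) t cl(1) C(1-3)[OF mem(1)] dom(5)[OF mem(1) t cl(1)]
          tendsto_const[of 0]] by (simp add: qm Bm_def)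
  qed simp
  \<comment> \<open>The flux enters at \<open>r\<close> and vanishes at the wall \<open>l\<close>,
    where the trace of \<open>q\<close> is \<open>0\<close>.\<close>
  have Ep: "((\<lambda>s. LINT x:Dp|lborel. ?e s x) has_real_derivative
      \<epsilon> * \<mu> * (LINT x:Dp|lborel. ?R t x) + Q * Bp - 0) (at t within {0..<T})"
  proof (rule p.energy_balance[OF t])
    \<comment> \<open>The chamber pressure is constant in \<open>x\<close>, so \<open>0\<close> is a
      potential of its derivative.\<close>
    show "((\<lambda>_. 0) has_real_derivative dx P t x) (at x)" if "x \<in> Dp" for x
      using dx_eq_0[where u = P and t = t, OF op(3) that P_const'] by simp
    show "((energy_flux \<epsilon> \<mu> T \<zeta> q (\<lambda>_. 0) t \<circ> real_of_ereal) \<longlongrightarrow> Q * Bp) (at_right (ereal r))"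
      unfolding ereal_tendsto_simps at_D[symmetric]
      using energy_flux_tendsto_bdry[OF op(3) t cl(4) C(1-3)[OF mem(3)] dom(5)[OF mem(3) t cl(4)]
          tendsto_const[of 0]] by (simp add: qp Bp_def)
    show "((energy_flux \<epsilon> \<mu> T \<zeta> q (\<lambda>_. 0) t \<circ> real_of_ereal) \<longlongrightarrow> 0) (at_left (ereal l))"
      unfolding ereal_tendsto_simps at_D[symmetric]
      using energy_flux_tendsto_bdry[OF op(3) t cl(5) C(1-3)[OF mem(3)] dom(5)[OF mem(3) t cl(5)]
          tendsto_const[of 0]] by (simp add: ql)
  qed simp
  let ?H = "\<epsilon> * (Q\<^sup>2 / (2 * (1 + \<epsilon> * \<zeta>w)\<^sup>2))"
  let ?F = "\<lambda>c. Q * (\<zeta>w + bdry_trace Di (P t) c / \<epsilon> + ?H)"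
  \<comment> \<open>Here the pressure itself is the potential, which is admissible because
    \<open>dx q\<close> vanishes in the interior.\<close>
  have Ei: "((\<lambda>s. LINT x:Di|lborel. ?e s x) has_real_derivative
      \<epsilon> * \<mu> * (LINT x:Di|lborel. ?R t x) + ?F (- r) - ?F r) (at t within {0..<T})"
  proof (rule i.energy_balance[OF t])
    note flux = interior_energy_flux[OF regular solution t, unfolded D_eq]
    show "(P t has_real_derivative dx P t x) (at x)" if "x \<in> Di" for x
      using has_derivative_dx[of 0, OF _ t that] C(5)[OF mem(2)] by simp
    show "dx q t x * P t x = 0" if "x \<in> Di" for x
      using flux(2)[OF that] by simp
    have lim: "(energy_flux \<epsilon> \<mu> T \<zeta> q (P t) t \<longlongrightarrow> ?F c) (at c within Di)" if "c \<in> closure Di" for c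
    proof (rule Lim_transform_eventually)
      show "((\<lambda>x. Q * (\<zeta>w + P t x / \<epsilon> + ?H)) \<longlongrightarrow> ?F c) (at c within Di)"
        using eps(1) by (intro tendsto_intros bdry_trace_tendsto[OF C(4)[OF mem(2)] op(2) t that]) auto
      show "eventually (\<lambda>x. Q * (\<zeta>w + P t x / \<epsilon> + ?H) = energy_flux \<epsilon> \<mu> T \<zeta> q (P t) t x) (at c within Di)"
        using flux(1) by (auto simp: eventually_at_filter Q_def)
    qed
    show "((energy_flux \<epsilon> \<mu> T \<zeta> q (P t) t \<circ> real_of_ereal) \<longlongrightarrow> ?F (- r)) (at_right (ereal (- r)))"
      unfolding ereal_tendsto_simps at_D[symmetric] by (rule lim[OF cl(2)])
    show "((energy_flux \<epsilon> \<mu> T \<zeta> q (P t) t \<circ> real_of_ereal) \<longlongrightarrow> ?F r) (at_left (ereal r))"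
      unfolding ereal_tendsto_simps at_D[symmetric] by (rule lim[OF cl(3)])
  qed

  \<comment> \<open>Mass enters the chamber at \<open>r\<close> with discharge \<open>Q\<close>, and
    none leaves at the wall.\<close>
  have "((\<lambda>s. LINT x:Dp|lborel. \<zeta> s x) has_real_derivative Q - 0) (at t within {0..<T})"
  proof (rule p.mass_balance[OF t])
    have "Ck_closure 0 T Dp (dt T \<zeta>)"
      using dom(2)[OF mem(3)] unfolding One_nat_def by (rule Ck_closure_dt)
    moreover have "bounded Dp" by (simp add: D_defs)
    ultimately show "dominated T Dp \<zeta>" "dominated T Dp (dt T \<zeta>)"
      using C(1)[OF mem(3)] op(3) by (simp_all add: dominated_bounded loc_bdd_bounded)
    show "((q t \<circ> real_of_ereal) \<longlongrightarrow> Q) (at_right (ereal r))"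
      using bdry_trace_tendsto[OF C(2)[OF mem(3)] op(3) t cl(4)]
      by (simp add: ereal_tendsto_simps qp at_D)
    show "((q t \<circ> real_of_ereal) \<longlongrightarrow> 0) (at_left (ereal l))"
      using bdry_trace_tendsto[OF C(2)[OF mem(3)] op(3) t cl(5)]
      by (simp add: ereal_tendsto_simps ql at_D)
  qed
  then have mean: "((\<lambda>s. mean_plus r l (\<zeta> s)) has_real_derivative Q / (l - r)) (at t within {0..<T})"
    unfolding mean_plus_def D_eq using geom(2) by (auto intro!: derivative_eq_intros)
  \<comment> \<open>The factor \<open>l - r\<close> of the chamber energy cancels the denominator in
    the rate \<open>Q / (l - r)\<close> of the mean.\<close>
  have "((\<lambda>s. (P0 * (l - r)) / 2 * (mean_plus r l (\<zeta> s))\<^sup>2) has_real_derivative P0 * M * Q)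
      (at t within {0..<T})"
    by (rule derivative_eq_intros mean refl)+ (use geom in \<open>simp add: M_def field_simps\<close>)
  note deriv = DERIV_add[OF DERIV_add[OF DERIV_add[OF Em Ei] Ep] this]

  have split: "(LINT x:{..<l}|lborel. u s x)
      = (LINT x:Dm|lborel. u s x) + (LINT x:Di|lborel. u s x) + (LINT x:Dp|lborel. u s x)"
    if "s \<in> {0..<T}" "dominated T Dm u" "dominated T Di u" "dominated T Dp u" for s u
    unfolding D_defs
    by (rule set_integral_split) (use geom that op in \<open>auto simp: D_defs intro!: dominated_integrable\<close>)
  note split_e = split[OF _ m.dominated_energy i.dominated_energy p.dominated_energy]
  note split_R = split[OF t m.dominated_remainder i.dominated_remainder p.dominated_remainder]
  have E_tot_eq: "(LINT x:Dm|lborel. ?e s x) + (LINT x:Di|lborel. ?e s x) + (LINT x:Dp|lborel. ?e s x)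
      + (P0 * (l - r)) / 2 * (mean_plus r l (\<zeta> s))\<^sup>2 = E_tot \<epsilon> \<mu> r l P0 \<zeta> q s" if "s \<in> {0..<T}" for s
    using split_e[OF that] by (simp add: E_tot_def energy_density_def)

  have bm: "\<zeta>w + bdry_trace Di (P t) (- r) / \<epsilon> + ?H = Bm"
    using bernoulli_minus[OF t] by (simp add: trace_Ext D_eq Q_def Bm_def)
  \<comment> \<open>Since \<open>\<kappa> = 0\<close>, the memory term drops out and
    \<open>chamber_term\<close> equals \<open>P0 * M\<close>, the excess of the interior side over
    \<open>Bp\<close>.\<close>
  have bp: "\<zeta>w + bdry_trace Di (P t) r / \<epsilon> + ?H = Bp + P0 * M"
    using bernoulli_plus[OF t] kappa
    by (simp add: trace_Ext D_eq Q_def Bp_def M_def chamber_term_def)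
  \<comment> \<open>The splitting of \<open>E_tot\<close> holds for times in \<open>{0..<T}\<close>,
    the set within which the derivative is taken.\<close>
  have "(E_tot \<epsilon> \<mu> r l P0 \<zeta> q has_real_derivative
      (\<epsilon> * \<mu> * (LINT x:Dm|lborel. ?R t x) + 0 - Q * Bm)
      + (\<epsilon> * \<mu> * (LINT x:Di|lborel. ?R t x) + ?F (- r) - ?F r)
      + (\<epsilon> * \<mu> * (LINT x:Dp|lborel. ?R t x) + Q * Bp - 0) + P0 * M * Q) (at t within {0..<T})"
    by (rule has_field_derivative_transform_within[OF deriv zero_less_one t]) (use E_tot_eq in simp)
  \<comment> \<open>By \<open>bm\<close> the fluxes at \<open>- r\<close> cancel; by
    \<open>bp\<close> those at \<open>r\<close> leave \<open>- Q * (P0 * M)\<close>, which the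
    derivative of the chamber energy balances.\<close>
  also have "(\<epsilon> * \<mu> * (LINT x:Dm|lborel. ?R t x) + 0 - Q * Bm)
      + (\<epsilon> * \<mu> * (LINT x:Di|lborel. ?R t x) + ?F (- r) - ?F r)
      + (\<epsilon> * \<mu> * (LINT x:Dp|lborel. ?R t x) + Q * Bp - 0) + P0 * M * Q
      = \<epsilon> * \<mu> * (LINT x:{..<l}|lborel. ?R t x)"
    unfolding bm bp split_R by (simp add: algebra_simps)
  finally show "(E_tot \<epsilon> \<mu> r l P0 \<zeta> q has_real_derivative
       \<epsilon> * \<mu> * (LINT x:{..<l}|lborel. remainder \<epsilon> T \<zeta> q t x)) (at t within {0..<T})" .
qed

end
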